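(* Let $A_0,\ldots,A_N\in\mathbb{R}^{n\times n}$ and $\mu\in\mathbb{R}$, and consider the time-invariant system $\dot X(t)=\mathcal{C}(X(t))$, $X(0)=X_0\in\mathbb{S}^n_{\succeq0}$, where $\mathcal{C}:\mathbb{S}^n\to\mathbb{S}^n$, $$\mathcal{C}(X)=A_0X+XA_0^T+\sum_{i=1}^NA_iXA_i^T+\mu X,\qquad \mathcal{C}^*(P)=A_0^TP+PA_0+\sum_{i=1}^NA_i^TPA_i+\mu P.$$ The following statements are equivalent: (a) The system is exponentially stable. (b) There exist constant matrices $P,Q\in\mathbb{S}^n_{\succ0}$ such that $\mathcal{C}^*(P)+Q=0$; and, equivalently, there exist $P\in\mathbb{S}^n_{\succ0}$ and $\alpha_3>0$ such that $\mathcal{C}^*(P)\preceq-\alpha_3I$. (c) The matrix $$\mathcal{M}_{\mathcal{C}}:=F^T\Big(I_n\otimes A_0+A_0\otimes I_n+\sum_{i=1}^NA_i\otimes A_i+\mu I_{n^2}\Big)F$$ is Hurwitz stable, where $F\in\mathbb{R}^{n^2\times n(n+1)/2}$, $F^TF=I$, is the matrix such that $\mathrm{vec}(X)=F\,\overline{\mathrm{vec}}(X)$ for all $X\in\mathbb{S}^n$. (d) $\mathrm{sp}(\mathcal{C})\subset\mathbb{C}_{<0}$, where $\mathrm{sp}(\mathcal{C}):=\{\lambda\in\mathbb{C}:\ \mathcal{C}(X)=\lambda X\text{ for some }X\in\mathbb{S}^n,\ X\neq0\}$.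
   Context: $\mathbb{S}^n$, $\mathbb{S}^n_{\succeq0}$, $\mathbb{S}^n_{\succ0}$ denote the real symmetric, positive semidefinite and positive definite $n\times n$ matrices; $\preceq$ is the Loewner order. $\mathbb{C}_{<0}$ is the open left half-plane. Hurwitz stable means all eigenvalues lie in $\mathbb{C}_{<0}$. $\otimes$ is the Kronecker product and $\mathrm{vec}$ stacks the columns of a matrix. For $X\in\mathbb{S}^n$, $\overline{\mathrm{vec}}(X)\in\mathbb{R}^{n(n+1)/2}$ is the column vector with successive entries $X_{11},\sqrt2X_{21},\ldots,\sqrt2X_{n1},X_{22},\sqrt2X_{32},\ldots,\sqrt2X_{n2},\ldots,X_{nn}$. Exponentially stable means that there exist $\alpha>0$, $\beta\ge1$ such that $\|X(t)\|\le\beta e^{-\alpha t}\|X_0\|$ for all $t\ge0$ and all $X_0\in\mathbb{S}^n_{\succeq0}$. *)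

theory Defs
  imports "HOL-Analysis.Analysis"
begin

text \<open>
  Matrices are elements of \<open>real ^ 'n ^ 'n\<close> with \<open>X $ i $ j\<close> the entry in row \<open>i\<close>, column \<open>j\<close>;
  the library norm on this type is the Frobenius norm.
\<close>

definition sym_mats :: "(real ^ 'n ^ 'n) set" where
  "sym_mats = {X. transpose X = X}"

definition psd_mats :: "(real ^ 'n ^ 'n) set" where
  "psd_mats = {X \<in> sym_mats. \<forall>v. 0 \<le> v \<bullet> (X *v v)}"

definition pd_mats :: "(real ^ 'n ^ 'n) set" where
  "pd_mats = {X \<in> sym_mats. \<forall>v. v \<noteq> 0 \<longrightarrow> 0 < v \<bullet> (X *v v)}"

definition loewner_le :: "real ^ 'n ^ 'n \<Rightarrow> real ^ 'n ^ 'n \<Rightarrow> bool"  (infix "\<preceq>\<^sub>L" 50) where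
  "X \<preceq>\<^sub>L Y \<longleftrightarrow> X \<in> sym_mats \<and> Y \<in> sym_mats \<and> Y - X \<in> psd_mats"

definition lyap_op :: "(nat \<Rightarrow> real ^ 'n ^ 'n) \<Rightarrow> nat \<Rightarrow> real \<Rightarrow> real ^ 'n ^ 'n \<Rightarrow> real ^ 'n ^ 'n" where
  "lyap_op A N \<mu> X =
     A 0 ** X + X ** transpose (A 0) + (\<Sum>i=1..N. A i ** X ** transpose (A i)) + \<mu> *\<^sub>R X"

definition lyap_adj :: "(nat \<Rightarrow> real ^ 'n ^ 'n) \<Rightarrow> nat \<Rightarrow> real \<Rightarrow> real ^ 'n ^ 'n \<Rightarrow> real ^ 'n ^ 'n" where
  "lyap_adj A N \<mu> P =
     transpose (A 0) ** P + P ** A 0 + (\<Sum>i=1..N. transpose (A i) ** P ** A i) + \<mu> *\<^sub>R P"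

definition is_solution ::
  "(real ^ 'n ^ 'n \<Rightarrow> real ^ 'n ^ 'n) \<Rightarrow> real ^ 'n ^ 'n \<Rightarrow> (real \<Rightarrow> real ^ 'n ^ 'n) \<Rightarrow> bool" where
  "is_solution L X0 X \<longleftrightarrow>
     X 0 = X0 \<and>
     (\<forall>t\<ge>0. X t \<in> sym_mats \<and> (X has_vector_derivative L (X t)) (at t within {0..}))"

definition exponentially_stable :: "(real ^ 'n ^ 'n \<Rightarrow> real ^ 'n ^ 'n) \<Rightarrow> bool" where
  "exponentially_stable L \<longleftrightarrow>
     (\<exists>\<alpha>>0. \<exists>\<beta>\<ge>1. \<forall>X0\<in>psd_mats. \<forall>X. is_solution L X0 X \<longrightarrow>
        (\<forall>t\<ge>0. norm (X t) \<le> \<beta> * exp (- \<alpha> * t) * norm X0))"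

text \<open>
  Vectors of length \<open>n\<^sup>2\<close> are indexed by pairs (column, row).  The lexicographic order of the
  pairs is the order in which stacking the columns lists the entries.
\<close>

definition vec_mat :: "real ^ 'n ^ 'n \<Rightarrow> real ^ ('n \<times> 'n)" where
  "vec_mat X = (\<chi> p. X $ snd p $ fst p)"

definition kronecker :: "real ^ 'n ^ 'n \<Rightarrow> real ^ 'n ^ 'n \<Rightarrow> real ^ ('n \<times> 'n) ^ ('n \<times> 'n)"
    (infixl "\<otimes>\<^sub>K" 70) where
  "A \<otimes>\<^sub>K B = (\<chi> p q. A $ fst p $ fst q * B $ snd p $ snd q)"

text \<open>
  The positions (column, row) on or below the diagonal; again the lexicographic order is the order
  in which the entries of the half-vectorization are listed.
\<close>

typedef (overloaded) ('n::linorder) low_tri = "{p :: 'n \<times> 'n. fst p \<le> snd p}"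
  by auto

instance low_tri :: ("{finite, linorder}") finite
proof
  have "inj (Rep_low_tri :: 'a low_tri \<Rightarrow> _)"
    by (simp add: inj_def Rep_low_tri_inject)
  then show "finite (UNIV :: 'a low_tri set)"
    by (rule finite_imageD[rotated]) (rule finite_subset[OF subset_UNIV finite])
qed

lemma card_low_tri:
  "CARD('n::{finite, linorder} low_tri) = CARD('n) * (CARD('n) + 1) div 2"
proof -
  let ?L = "{p :: 'n \<times> 'n. fst p \<le> snd p}" and ?U = "{p :: 'n \<times> 'n. snd p \<le> fst p}"
  have L: "CARD('n low_tri) = card ?L"
    by (rule type_definition.card[OF type_definition_low_tri])
  have "bij_betw prod.swap ?L ?U"
    by (rule bij_betwI[of _ _ _ prod.swap]) auto
  then have U: "card ?U = card ?L"
    by (simp add: bij_betw_same_card)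
  have "?L \<union> ?U = UNIV"
    by auto
  then have un: "card (?L \<union> ?U) = CARD('n) * CARD('n)"
    by (metis UNIV_Times_UNIV card_cartesian_product)
  have "?L \<inter> ?U = (\<lambda>i. (i, i)) ` UNIV"
    by (auto simp: image_iff)
  then have int: "card (?L \<inter> ?U) = CARD('n)"
    by (simp add: card_image inj_on_def)
  have "card ?L + card ?U = card (?L \<union> ?U) + card (?L \<inter> ?U)"
    by (rule card_Un_Int) simp_all
  then show ?thesis
    unfolding L U un int by simp
qed

definition vec_bar :: "real ^ ('n::{finite, linorder}) ^ ('n::{finite, linorder}) \<Rightarrow> real ^ 'n low_tri" where
  "vec_bar X = (\<chi> k. let (j, i) = Rep_low_tri k in
                       if i = j then X $ i $ j else sqrt 2 * X $ i $ j)"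

lemma vec_mat_eq_vec_bar_exists:
  "\<exists>F :: real ^ ('n::{finite, linorder}) low_tri ^ ('n \<times> 'n).
     transpose F ** F = mat 1 \<and> (\<forall>X\<in>sym_mats. vec_mat X = F *v vec_bar X)"
proof -
  define s where "s k = {Rep_low_tri k, prod.swap (Rep_low_tri k)}" for k :: "'n low_tri"
  define c :: "'n low_tri \<Rightarrow> real"
    where "c k = (if fst (Rep_low_tri k) = snd (Rep_low_tri k) then 1 else 1 / sqrt 2)" for k
  define F :: "real ^ 'n low_tri ^ ('n \<times> 'n)"
    where "F = (\<chi> p k. if p \<in> s k then c k else 0)"
  have same: "k = k'" if "p \<in> s k" "p \<in> s k'" for p k k'
  proof -
    have "fst (Rep_low_tri k) \<le> snd (Rep_low_tri k)" "fst (Rep_low_tri k') \<le> snd (Rep_low_tri k')"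
      using Rep_low_tri[of k] Rep_low_tri[of k'] by auto
    with that have "Rep_low_tri k = Rep_low_tri k'"
      by (cases "Rep_low_tri k"; cases "Rep_low_tri k'") (auto simp: s_def)
    then show ?thesis
      by (simp add: Rep_low_tri_inject)
  qed
  have norm1: "(\<Sum>p\<in>s k. c k * c k) = 1" for k
    by (cases "Rep_low_tri k") (auto simp: s_def c_def)
  have "(\<Sum>p\<in>UNIV. F $ p $ k * F $ p $ k') = (if k = k' then 1 else 0)" for k k'
  proof (cases "k = k'")
    case True
    have "(\<Sum>p\<in>UNIV. F $ p $ k * F $ p $ k') = (\<Sum>p\<in>UNIV. if p \<in> s k then c k * c k else 0)"
      using True by (intro sum.cong) (auto simp: F_def)
    also have "\<dots> = (\<Sum>p\<in>s k. c k * c k)"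
      by (simp add: sum.If_cases)
    finally show ?thesis
      using True norm1 by simp
  next
    case False
    then have "F $ p $ k * F $ p $ k' = 0" for p
      using same[of p k k'] by (auto simp: F_def)
    then show ?thesis
      using False by (simp only: sum.neutral_const if_False)
  qed
  then have orth: "transpose F ** F = mat 1"
    by (simp add: vec_eq_iff matrix_matrix_mult_def transpose_def mat_def)
  have "vec_mat X = F *v vec_bar X" if X: "X \<in> sym_mats" for X
  proof -
    have sym: "X $ i $ j = X $ j $ i" for i j
    proof -
      have "transpose X $ i $ j = X $ i $ j"
        using X by (simp add: sym_mats_def)
      then show ?thesis
        by (simp add: transpose_def)
    qed
    have "(\<Sum>k\<in>UNIV. F $ (j, i) $ k * vec_bar X $ k) = X $ i $ j" for j i
    proof -
      define k0 where "k0 = Abs_low_tri (min i j, max i j)"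
      have r: "Rep_low_tri k0 = (min i j, max i j)"
        unfolding k0_def by (rule Abs_low_tri_inverse) (auto simp: min_def max_def)
      have mem: "(j, i) \<in> s k0"
        by (cases "i \<le> j") (auto simp add: s_def r)
      have "F $ (j, i) $ k = 0" if "k \<in> UNIV - {k0}" for k
        using that same[OF mem, of k] by (auto simp: F_def)
      then have "(\<Sum>k\<in>UNIV. F $ (j, i) $ k * vec_bar X $ k)
          = (\<Sum>k\<in>{k0}. F $ (j, i) $ k * vec_bar X $ k)"
        by (intro sum.mono_neutral_right) auto
      also have "\<dots> = F $ (j, i) $ k0 * vec_bar X $ k0"
        by simp
      also have "F $ (j, i) $ k0 = c k0"
        using mem by (simp add: F_def)
      also have "c k0 * vec_bar X $ k0 = X $ max i j $ min i j"
        by (simp add: c_def vec_bar_def r)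
      also have "\<dots> = X $ i $ j"
        by (cases "i \<le> j") (simp_all add: min_absorb1 min_absorb2 max_absorb1 max_absorb2 sym[of j i])
      finally show ?thesis .
    qed
    then show ?thesis
      by (simp add: vec_eq_iff vec_mat_def matrix_vector_mult_def)
  qed
  with orth show ?thesis
    by blast
qed

definition lyap_matrix ::
  "(nat \<Rightarrow> real ^ ('n::{finite, linorder}) ^ ('n::{finite, linorder})) \<Rightarrow> nat \<Rightarrow> real
     \<Rightarrow> real ^ 'n low_tri ^ ('n \<times> 'n) \<Rightarrow> real ^ 'n low_tri ^ 'n low_tri" where
  "lyap_matrix A N \<mu> F =
     transpose F **
       (mat 1 \<otimes>\<^sub>K A 0 + A 0 \<otimes>\<^sub>K mat 1 + (\<Sum>i=1..N. A i \<otimes>\<^sub>K A i) + \<mu> *\<^sub>R mat 1) ** F"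

definition complex_mat :: "real ^ 'm ^ 'k \<Rightarrow> complex ^ 'm ^ 'k" where
  "complex_mat M = (\<chi> i j. complex_of_real (M $ i $ j))"

definition eigenvalues :: "real ^ 'k ^ 'k \<Rightarrow> complex set" where
  "eigenvalues M = {z. \<exists>v. v \<noteq> 0 \<and> complex_mat M *v v = z *s v}"

definition hurwitz_stable :: "real ^ 'k ^ 'k \<Rightarrow> bool" where
  "hurwitz_stable M \<longleftrightarrow> eigenvalues M \<subseteq> {z. Re z < 0}"

definition op_spectrum :: "(real ^ 'n ^ 'n \<Rightarrow> real ^ 'n ^ 'n) \<Rightarrow> complex set" where
  "op_spectrum L =
     {z. \<exists>X\<in>sym_mats. X \<noteq> 0 \<and> complex_mat (L X) = (\<chi> i j. z * complex_mat X $ i $ j)}"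

text \<open>
  Eigenmatrices in \<^const>\<open>op_spectrum\<close> are real, so it contains only the real eigenvalues.  The
  eigenvalues of the complexification \<open>U + \<i> V \<mapsto> L U + \<i> L V\<close>, with \<open>U\<close> and \<open>V\<close> real symmetric,
  include the non-real ones.
\<close>

definition op_spectrum_complex :: "(real ^ 'n ^ 'n \<Rightarrow> real ^ 'n ^ 'n) \<Rightarrow> complex set" where
  "op_spectrum_complex L =
     {z. \<exists>U\<in>sym_mats. \<exists>V\<in>sym_mats. (U \<noteq> 0 \<or> V \<noteq> 0) \<and>
        (\<forall>i j. Complex (L U $ i $ j) (L V $ i $ j) = z * Complex (U $ i $ j) (V $ i $ j))}"

end

theory Submission
  imports Defs
begin

text \<open>
  The operator \<open>C\<close> and its adjoint are quasi-positive: if \<open>X\<close> is positive semidefinite and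
  \<open>X v = 0\<close>, then \<open>v \<bullet> C(X) v \<ge> 0\<close>.  For every such operator \<open>G\<close> the following implications hold.
  A positive definite \<open>P\<close> with \<open>G P\<close> negative definite gives exponential stability, because
  \<open>s exp (- a t) P\<close> dominates \<open>X(t)\<close> and \<open>- X(t)\<close> in the Loewner order.  Exponential stability
  excludes complex eigenvalues with nonnegative real part, because their eigenmatrices yield solutions
  that do not decay.  If there is no real eigenvalue in \<open>[0, \<infinity>)\<close>, then \<open>G P = - I\<close> has a
  positive definite solution, by following the resolvent \<open>(l - G)\<^sup>-\<^sup>1 I\<close> from large \<open>l\<close> down to
  \<open>l = 0\<close>.  Since \<open>C\<close> and its adjoint have the same real eigenvalues, the cycle closes although
  statement (b) is about the adjoint.
\<close>

section \<open>Symmetric, positive semidefinite and positive definite matrices\<close>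

text \<open>The rank-one matrix \<open>v v^T\<close>. Pairing with it turns the quadratic form at
  \<open>v\<close> into a linear functional of the matrix, from which continuity, closedness and
  derivatives of forms follow.\<close>

definition outer :: "real ^ 'n \<Rightarrow> real ^ 'n ^ 'n" where
  "outer v = (\<chi> i j. v $ i * v $ j)"

lemma quadratic_form_eq_inner: "v \<bullet> (X *v v) = X \<bullet> outer v"
  by (simp add: inner_vec_def outer_def matrix_vector_mult_def sum_distrib_left mult_ac)

lemma norm_outer: "norm (outer v) = v \<bullet> v"
proof -
  have "outer v \<bullet> outer v = (v \<bullet> v)\<^sup>2"
    by (simp add: inner_vec_def outer_def power2_eq_square sum_product mult_ac)
  then show ?thesis
    by (simp add: norm_eq_sqrt_inner)
qed

lemma abs_quadratic_form_le: "\<bar>v \<bullet> (X *v v)\<bar> \<le> norm X * (v \<bullet> v)"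
  for X :: "real ^ 'n ^ 'n"
  unfolding quadratic_form_eq_inner norm_outer[symmetric] by (rule Cauchy_Schwarz_ineq2)

lemma continuous_on_outer [continuous_intros]:
  "continuous_on S f \<Longrightarrow> continuous_on S (\<lambda>x. outer (f x))"
  unfolding outer_def by (intro continuous_intros)

lemma matrix_vector_mult_scaleR_left: "(c *\<^sub>R X) *v v = c *\<^sub>R (X *v v)" for X :: "real ^ 'n ^ 'm"
  by (simp add: scaleR_matrix_vector_assoc)

lemma subspace_sym_mats: "subspace (sym_mats :: (real ^ 'n ^ 'n) set)"
  by (auto simp: subspace_def sym_mats_def transpose_def vec_eq_iff)

lemma mat_1_sym: "mat 1 \<in> sym_mats"
  by (simp add: sym_mats_def)

lemmas sym_mats_intros =
  subspace_add[OF subspace_sym_mats] subspace_diff[OF subspace_sym_mats]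
  subspace_scale[OF subspace_sym_mats] subspace_neg[OF subspace_sym_mats]
  subspace_0[OF subspace_sym_mats] subspace_sum[OF subspace_sym_mats] mat_1_sym

lemma sym_inner_mult: "X \<in> sym_mats \<Longrightarrow> v \<bullet> (X *v w) = w \<bullet> (X *v v)" for X :: "real ^ 'n ^ 'n"
  by (metis (mono_tags, lifting) dot_lmul_matrix inner_commute mem_Collect_eq sym_mats_def
      transpose_matrix_vector)

lemma pd_imp_psd: "X \<in> pd_mats \<Longrightarrow> X \<in> psd_mats"
  by (auto simp: pd_mats_def psd_mats_def) (metis inner_zero_left less_eq_real_def)

lemma psd_in_sym: "X \<in> psd_mats \<Longrightarrow> X \<in> sym_mats"
  by (simp add: psd_mats_def)

lemma pd_in_sym: "X \<in> pd_mats \<Longrightarrow> X \<in> sym_mats"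
  by (simp add: pd_mats_def)

lemma psd_nonneg: "X \<in> psd_mats \<Longrightarrow> 0 \<le> v \<bullet> (X *v v)"
  by (simp add: psd_mats_def)

lemma pd_pos: "X \<in> pd_mats \<Longrightarrow> v \<noteq> 0 \<Longrightarrow> 0 < v \<bullet> (X *v v)"
  by (simp add: pd_mats_def)

lemma mat_1_pd: "mat 1 \<in> pd_mats"
  by (simp add: pd_mats_def mat_1_sym)

lemma psd_add_pd: "X \<in> psd_mats \<Longrightarrow> Y \<in> pd_mats \<Longrightarrow> X + Y \<in> pd_mats"
  by (auto simp: psd_mats_def pd_mats_def sym_mats_intros algebra_simps add_nonneg_pos)

lemma psd_scaleR: "X \<in> psd_mats \<Longrightarrow> 0 \<le> c \<Longrightarrow> c *\<^sub>R X \<in> psd_mats"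
  by (auto simp: psd_mats_def sym_mats_intros matrix_vector_mult_scaleR_left)

lemma pd_scaleR: "X \<in> pd_mats \<Longrightarrow> 0 < c \<Longrightarrow> c *\<^sub>R X \<in> pd_mats"
  by (auto simp: pd_mats_def sym_mats_intros matrix_vector_mult_scaleR_left)

text \<open>Otherwise a small step from \<open>v\<close> against \<open>X *v v\<close> would make
  the form negative, since the linear decrease outweighs the quadratic term.\<close>

lemma psd_kernel:
  assumes X: "X \<in> psd_mats" and v: "v \<bullet> (X *v v) = 0"
  shows "X *v v = 0"
proof (rule ccontr)
  define w where "w = X *v v"
  assume "X *v v \<noteq> 0"
  then have ww: "0 < w \<bullet> w"
    by (simp add: w_def)
  have wv: "v \<bullet> (X *v w) = w \<bullet> w"
    using sym_inner_mult[OF psd_in_sym[OF X], of v w] by (simp add: w_def)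
  define q where "q = w \<bullet> (X *v w)"
  have q: "0 \<le> q"
    using X by (simp add: psd_mats_def q_def)
  \<comment> \<open>This step size keeps \<open>s * q\<close> at most \<open>w \<bullet> w\<close>,
    while the linear term contributes twice that; the \<open>+ 1\<close> covers
    \<open>q = 0\<close>.\<close>
  define s where "s = (w \<bullet> w) / (q + 1)"
  have s: "0 < s"
    using q ww by (simp add: s_def)
  have "0 \<le> (v - s *\<^sub>R w) \<bullet> (X *v (v - s *\<^sub>R w))"
    using X by (simp add: psd_mats_def)
  also have "\<dots> = s * (s * q - 2 * (w \<bullet> w))"
    using v wv by (simp add: q_def algebra_simps inner_diff_left inner_diff_right w_def[symmetric]
        matrix_vector_mult_diff_distrib matrix_vector_mult_scaleR)
  finally have "2 * (w \<bullet> w) \<le> s * q"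
    using s by (simp add: zero_le_mult_iff)
  also have "\<dots> \<le> s * (q + 1)"
    using s by simp
  also have "\<dots> = w \<bullet> w"
    using q by (simp add: s_def)
  finally show False
    using ww by simp
qed

text \<open>The constant is the minimum on the unit sphere, attained by compactness; homogeneity of
  degree two extends the bound to all vectors.\<close>

lemma pd_lower_bound:
  fixes X :: "real ^ 'n ^ 'n"
  assumes X: "\<forall>v. v \<noteq> 0 \<longrightarrow> 0 < v \<bullet> (X *v v)"
  obtains c where "0 < c" "\<And>v. c * (v \<bullet> v) \<le> v \<bullet> (X *v v)"
proof -
  have "continuous_on (sphere 0 1) (\<lambda>v :: real ^ 'n. v \<bullet> (X *v v))"
    unfolding quadratic_form_eq_inner by (intro continuous_intros)
  moreover have "sphere 0 1 \<noteq> ({} :: (real ^ 'n) set)"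
    by simp
  ultimately have "\<exists>u\<in>sphere 0 1. \<forall>v\<in>sphere 0 1. u \<bullet> (X *v u) \<le> v \<bullet> (X *v v)"
    by (intro continuous_attains_inf compact_sphere)
  then obtain u :: "real ^ 'n" where u: "u \<in> sphere 0 1"
    and min: "\<And>v. v \<in> sphere 0 1 \<Longrightarrow> u \<bullet> (X *v u) \<le> v \<bullet> (X *v v)"
    by blast
  show thesis
  proof
    have "u \<noteq> 0"
      using u by auto
    then show "0 < u \<bullet> (X *v u)"
      using X by blast
    show "u \<bullet> (X *v u) * (v \<bullet> v) \<le> v \<bullet> (X *v v)" for v
    proof (cases "v = 0")
      case False
      define w where "w = (1 / norm v) *\<^sub>R v"
      have vw: "v = norm v *\<^sub>R w"
        using False by (simp add: w_def)
      have "u \<bullet> (X *v u) \<le> w \<bullet> (X *v w)"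
        using False by (intro min) (simp add: w_def)
      then have "u \<bullet> (X *v u) * (norm v)\<^sup>2 \<le> w \<bullet> (X *v w) * (norm v)\<^sup>2"
        by (simp add: mult_right_mono)
      also have "\<dots> = v \<bullet> (X *v v)"
        using vw by (metis (no_types, opaque_lifting) inner_scaleR_left inner_scaleR_right
            matrix_vector_mult_scaleR mult.commute mult.assoc power2_eq_square)
      finally show ?thesis
        by (simp add: power2_norm_eq_inner)
    qed simp
  qed
qed

text \<open>The set is not restricted to \<open>sym_mats\<close>, which is in general a proper
  subspace, so that \<open>pd_mats\<close> has no interior. Perturbations smaller than the constant
  of \<open>pd_lower_bound\<close> keep the form positive.\<close>

lemma open_positive_forms:
  "open {X :: real ^ 'n ^ 'n. \<forall>v. v \<noteq> 0 \<longrightarrow> 0 < v \<bullet> (X *v v)}"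
proof (rule openI, elim CollectE)
  fix X :: "real ^ 'n ^ 'n"
  assume "\<forall>v. v \<noteq> 0 \<longrightarrow> 0 < v \<bullet> (X *v v)"
  then obtain c where c: "0 < c" "\<And>v. c * (v \<bullet> v) \<le> v \<bullet> (X *v v)"
    using pd_lower_bound by blast
  have "0 < v \<bullet> (Y *v v)" if "dist X Y < c" "v \<noteq> 0" for Y v
  proof -
    have "\<bar>v \<bullet> ((X - Y) *v v)\<bar> \<le> norm (X - Y) * (v \<bullet> v)"
      by (rule abs_quadratic_form_le)
    also have "\<dots> < c * (v \<bullet> v)"
      using that by (intro mult_strict_right_mono) (auto simp: dist_norm)
    also have "\<dots> \<le> v \<bullet> (X *v v)"
      by (rule c)
    finally show ?thesis
      by (simp add: algebra_simps inner_diff_right)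
  qed
  with c(1) show "\<exists>e>0. ball X e \<subseteq> {X. \<forall>v. v \<noteq> 0 \<longrightarrow> 0 < v \<bullet> (X *v v)}"
    by (intro exI[of _ c]) auto
qed

lemma closed_psd_mats: "closed (psd_mats :: (real ^ 'n ^ 'n) set)"
proof -
  have "psd_mats = sym_mats \<inter> (\<Inter>v. {X :: real ^ 'n ^ 'n. 0 \<le> X \<bullet> outer v})"
    by (auto simp: psd_mats_def quadratic_form_eq_inner)
  also have "closed \<dots>"
    by (intro closed_Int closed_INT ballI closed_subspace subspace_sym_mats closed_Collect_le
        continuous_intros)
  finally show ?thesis .
qed

text \<open>Converts a norm bound into a Loewner bound: the form of \<open>X\<close> is at most
  \<open>norm X\<close> times the squared length, that of \<open>P\<close> at least \<open>c\<close>
  times.\<close>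

lemma scaled_pd_minus_psd:
  assumes X: "X \<in> sym_mats" and P: "P \<in> pd_mats"
    and c: "\<And>v. c * (v \<bullet> v) \<le> v \<bullet> (P *v v)" and s: "0 \<le> s" "norm X \<le> s * c"
  shows "s *\<^sub>R P - X \<in> psd_mats"
  unfolding psd_mats_def
proof (intro CollectI conjI allI)
  show "s *\<^sub>R P - X \<in> sym_mats"
    by (intro sym_mats_intros X pd_in_sym P)
  fix v
  have "v \<bullet> (X *v v) \<le> norm X * (v \<bullet> v)"
    using abs_quadratic_form_le[of v X] by linarith
  also have "\<dots> \<le> s * c * (v \<bullet> v)"
    using s by (intro mult_right_mono) auto
  also have "\<dots> \<le> s * (v \<bullet> (P *v v))"
    using c[of v] s mult_left_mono by (fastforce simp: mult.assoc)
  finally show "0 \<le> v \<bullet> ((s *\<^sub>R P - X) *v v)"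
    by (simp add: algebra_simps inner_diff_right matrix_vector_mult_scaleR_left)
qed

lemma identity_shift_psd: "X \<in> sym_mats \<Longrightarrow> norm X *\<^sub>R mat 1 - X \<in> psd_mats"
  by (rule scaled_pd_minus_psd[where c = 1]) (auto simp: mat_1_pd)

text \<open>Converts a bound on the form back into a norm bound. Polarization recovers each entry
  from the form at sums and differences of unit vectors; the factor counts the entries.\<close>

lemma norm_le_quadratic_form_bound:
  fixes X :: "real ^ 'n ^ 'n"
  assumes X: "X \<in> sym_mats" and r: "\<And>v. \<bar>v \<bullet> (X *v v)\<bar> \<le> r * (v \<bullet> v)"
  shows "norm X \<le> real (CARD('n) * CARD('n)) * r"
proof -
  have entry: "\<bar>X $ i $ j\<bar> \<le> r" for i j
  proof -
    let ?p = "axis i 1 + axis j 1 :: real ^ 'n" and ?m = "axis i 1 - axis j 1 :: real ^ 'n"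
    have ij: "axis i 1 \<bullet> (X *v axis j 1) = X $ i $ j"
      by (simp add: matrix_vector_mult_basis column_def inner_axis')
    have "?p \<bullet> (X *v ?p) - ?m \<bullet> (X *v ?m) = 4 * X $ i $ j"
      using sym_inner_mult[OF X, of "axis j 1" "axis i 1"] ij
      by (simp add: algebra_simps inner_add_left inner_add_right inner_diff_left inner_diff_right
          matrix_vector_mult_diff_distrib)
    \<comment> \<open>The squared lengths add up to 4 also when \<open>i = j\<close>, so one
      estimate covers diagonal and off-diagonal entries.\<close>
    moreover have "?p \<bullet> ?p + ?m \<bullet> ?m = 4"
      by (simp add: inner_add_left inner_add_right inner_diff_left inner_diff_right inner_axis_axis)
    then have "r * (?p \<bullet> ?p) + r * (?m \<bullet> ?m) = r * 4"
      by (metis distrib_left)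
    ultimately show ?thesis
      using r[of ?p] r[of ?m] by linarith
  qed
  have "norm X \<le> (\<Sum>i\<in>UNIV. norm (X $ i))"
    unfolding norm_vec_def by (rule L2_set_le_sum) simp
  also have "\<dots> \<le> (\<Sum>i\<in>UNIV. \<Sum>j\<in>UNIV. \<bar>X $ i $ j\<bar>)"
    by (intro sum_mono norm_le_l1_cart)
  also have "\<dots> \<le> (\<Sum>i\<in>(UNIV :: 'n set). \<Sum>j\<in>(UNIV :: 'n set). r)"
    by (intro sum_mono entry)
  finally show ?thesis
    by simp
qed

section \<open>Linear differential equations\<close>

lemma has_vector_derivative_componentwise:
  fixes f :: "real \<Rightarrow> 'a::euclidean_space"
  assumes "\<And>b. b \<in> Basis \<Longrightarrow> ((\<lambda>t. f t \<bullet> b) has_real_derivative f' \<bullet> b) (at t)"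
  shows "(f has_vector_derivative f') (at t)"
  using assms
  by (simp add: has_vector_derivative_def has_derivative_componentwise_within[of f]
      has_real_derivative_iff_has_vector_derivative)

text \<open>The solution is the exponential series \<open>exp (t L) x0\<close>. Its partial sums lie
  in \<open>S\<close>, which is closed as a subspace of finite dimension, so the limit stays in
  \<open>S\<close>.\<close>

lemma linear_ode_solution_exists:
  fixes L :: "'a::euclidean_space \<Rightarrow> 'a"
  assumes L: "linear L" and S: "subspace S" "\<And>x. x \<in> S \<Longrightarrow> L x \<in> S" and x0: "x0 \<in> S"
  obtains X where "X 0 = x0" "\<And>t. X t \<in> S"
    "\<And>t. (X has_vector_derivative L (X t)) (at t)"
proof -
  define a where "a k = (1 / fact k) *\<^sub>R (L ^^ k) x0" for k :: nat
  define X where "X t = (\<Sum>k. t ^ k *\<^sub>R a k)" for t :: real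
  obtain K where K: "\<And>x. norm (L x) \<le> norm x * K" "0 \<le> K"
    using bounded_linear.nonneg_bounded[OF linear_conv_bounded_linear[THEN iffD1, OF L]] by blast
  have pow: "norm ((L ^^ k) x0) \<le> K ^ k * norm x0" for k
  proof (induction k)
    case (Suc k)
    have "norm (L ((L ^^ k) x0)) \<le> norm ((L ^^ k) x0) * K"
      by (rule K)
    also have "\<dots> \<le> K ^ k * norm x0 * K"
      using Suc K by (intro mult_right_mono) auto
    finally show ?case
      by (simp add: mult_ac)
  qed simp
  have summ: "summable (\<lambda>k. t ^ k *\<^sub>R a k)" for t
  proof (rule summable_comparison_test')
    show "summable (\<lambda>k. norm x0 * ((K * \<bar>t\<bar>) ^ k /\<^sub>R fact k))"
      by (intro summable_mult summable_exp_generic)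
    show "norm (t ^ k *\<^sub>R a k) \<le> norm x0 * ((K * \<bar>t\<bar>) ^ k /\<^sub>R fact k)" for k
    proof -
      have "norm (t ^ k *\<^sub>R a k) = \<bar>t\<bar> ^ k / fact k * norm ((L ^^ k) x0)"
        by (simp add: a_def power_abs)
      also have "\<dots> \<le> \<bar>t\<bar> ^ k / fact k * (K ^ k * norm x0)"
        by (intro mult_left_mono pow) simp
      finally show ?thesis
        by (simp add: power_mult_distrib field_simps)
    qed
  qed
  have inS: "t ^ k *\<^sub>R a k \<in> S" for t k
  proof -
    have "(L ^^ k) x0 \<in> S"
      by (induction k) (auto simp: x0 S)
    then show ?thesis
      by (simp add: a_def S subspace_scale)
  qed
  show thesis
  proof
    have "X 0 = (\<Sum>k\<in>{0}. 0 ^ k *\<^sub>R a k)"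
      unfolding X_def by (rule suminf_finite) auto
    then show "X 0 = x0"
      by (simp add: a_def)
    show "X t \<in> S" for t
    proof -
      have "(\<lambda>n. \<Sum>k<n. t ^ k *\<^sub>R a k) \<longlonglongrightarrow> X t"
        unfolding X_def using summable_LIMSEQ[OF summ] .
      then show ?thesis
        by (rule closed_sequentially[OF closed_subspace[OF S(1)], rotated]) (intro subspace_sum S inS)
    qed
    show "(X has_vector_derivative L (X t)) (at t)" for t
    proof (rule has_vector_derivative_componentwise)
      fix b :: 'a
      define c where "c k = a k \<bullet> b" for k
      have sumc: "summable (\<lambda>k. c k * y ^ k)" for y
        using bounded_linear.summable[OF bounded_linear_inner_left[of b] summ[of y]]
        by (simp add: c_def mult.commute)
      have X: "X y \<bullet> b = (\<Sum>k. c k * y ^ k)" for y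
        using bounded_linear.suminf[OF bounded_linear_inner_left[of b] summ[of y]]
        by (simp add: c_def X_def mult.commute)
      \<comment> \<open>Applying \<open>L\<close> to a coefficient gives \<open>k + 1\<close> times
        the next one, which matches the termwise derivative \<open>diffs\<close> of the scalar
        series.\<close>
      have La: "L (a k) = real (Suc k) *\<^sub>R a (Suc k)" for k
        by (simp add: a_def linear_cmul[OF L] fact_Suc del: of_nat_Suc)
      have bl: "bounded_linear (\<lambda>x. L x \<bullet> b)"
        using L by (intro bounded_linear_inner_left_comp) (simp add: linear_conv_bounded_linear)
      have "L (X t) \<bullet> b = (\<Sum>k. L (t ^ k *\<^sub>R a k) \<bullet> b)"
        unfolding X_def by (rule bounded_linear.suminf[OF bl summ])
      also have "\<dots> = (\<Sum>k. diffs c k * t ^ k)"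
        by (simp only: linear_cmul[OF L] La diffs_def c_def inner_scaleR_left mult.commute mult.left_commute)
      finally show "((\<lambda>t. X t \<bullet> b) has_real_derivative L (X t) \<bullet> b) (at t)"
        unfolding X using termdiffs_strong_converges_everywhere[OF sumc] by simp
    qed
  qed
qed

section \<open>Quasi-positive operators\<close>

text \<open>The last assumption is a tangency condition at the boundary of the cone: where the form
  of \<open>X\<close> vanishes, the vector field \<open>G\<close> does not point outwards. Unlike
  positivity of \<open>G\<close>, it tolerates terms such as \<open>A X + X A^T\<close>.\<close>

locale quasi_positive =
  fixes G :: "real ^ 'n ^ 'n \<Rightarrow> real ^ 'n ^ 'n"
  assumes linear: "linear G"
    and sym: "X \<in> sym_mats \<Longrightarrow> G X \<in> sym_mats"
    and quasi_pos: "X \<in> psd_mats \<Longrightarrow> X *v v = 0 \<Longrightarrow> 0 \<le> v \<bullet> (G X *v v)"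
begin

text \<open>At the first time \<open>s\<close> when the form of \<open>Y\<close> fails to be
  positive at some unit vector \<open>v\<close>, quasi-positivity and the strict inequality give it
  a positive derivative, so it was negative shortly before, contradicting minimality.\<close>

lemma strict_comparison:
  assumes deriv: "\<And>t. 0 \<le> t \<Longrightarrow> (Y has_vector_derivative Y' t) (at t within {0..})"
    and sym_Y: "\<And>t. 0 \<le> t \<Longrightarrow> Y t \<in> sym_mats"
    and init: "Y 0 \<in> pd_mats"
    and ineq: "\<And>t. 0 \<le> t \<Longrightarrow> Y' t - G (Y t) \<in> pd_mats"
    and t: "0 \<le> t"
  shows "Y t \<in> pd_mats"
proof (rule ccontr)
  assume "Y t \<notin> pd_mats"
  define q where "q p = snd p \<bullet> (Y (fst p) *v snd p)" for p
  have contY: "continuous_on {0..} Y"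
    by (rule continuous_on_vector_derivative) (use deriv in auto)
  have contq: "continuous_on ({0..t} \<times> sphere 0 1) q"
    unfolding q_def quadratic_form_eq_inner
    by (intro continuous_intros continuous_on_compose2[OF contY]) auto
  \<comment> \<open>Restricting to unit vectors makes the set of violations compact, so an earliest
    one exists.\<close>
  define B where "B = {p \<in> {0..t} \<times> sphere 0 1. q p \<le> 0}"
  have "compact B"
  proof -
    have "closed ({0..t} \<times> sphere 0 1 \<inter> q -` {..0})"
      by (intro continuous_closed_preimage contq closed_Times) auto
    moreover have "B = ({0..t} \<times> sphere 0 1) \<inter> ({0..t} \<times> sphere 0 1 \<inter> q -` {..0})"
      by (auto simp: B_def)
    ultimately show ?thesis
      by (metis compact_Icc compact_Int_closed compact_Times compact_sphere)
  qed
  have B_mem: "\<exists>v. (s, v) \<in> B" if s: "0 \<le> s" "s \<le> t" "Y s \<notin> pd_mats" for s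
  proof -
    obtain v where v: "v \<noteq> 0" "v \<bullet> (Y s *v v) \<le> 0"
      using s sym_Y[of s] by (auto simp: pd_mats_def not_less)
    then have "(s, (1 / norm v) *\<^sub>R v) \<in> B"
      using s by (simp add: B_def q_def matrix_vector_mult_scaleR divide_nonpos_nonneg)
    then show ?thesis ..
  qed
  then have "B \<noteq> {}"
    using t B_mem[OF t order_refl \<open>Y t \<notin> pd_mats\<close>] by blast
  then have "\<exists>p\<in>B. \<forall>p'\<in>B. fst p \<le> fst p'"
    using \<open>compact B\<close> by (intro continuous_attains_inf continuous_intros)
  then obtain s v where sv: "(s, v) \<in> B" and first: "\<And>r w. (r, w) \<in> B \<Longrightarrow> s \<le> r"
    by force
  have s: "0 \<le> s" "s \<le> t" and v: "v \<noteq> 0" and nonpos: "v \<bullet> (Y s *v v) \<le> 0"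
    using sv by (auto simp: B_def q_def)
  have before: "Y r \<in> pd_mats" if "0 \<le> r" "r < s" for r
    using B_mem[of r] first that s by fastforce
  have "s \<noteq> 0"
    using pd_pos[OF _ v] init nonpos by (metis not_le)
  \<comment> \<open>As a left limit of positive definite matrices, \<open>Y s\<close> lies in the
    closed cone, so the form vanishes at \<open>v\<close> and \<open>quasi_pos\<close>
    applies.\<close>
  have psd: "Y s \<in> psd_mats"
  proof -
    have "closure {0..<s} = {0..s}"
      using s \<open>s \<noteq> 0\<close> by (intro closure_atLeastLessThan) auto
    moreover have "Y ` closure {0..<s} \<subseteq> psd_mats"
    proof (rule image_closure_subset[OF _ closed_psd_mats])
      show "continuous_on (closure {0..<s}) Y"
        unfolding calculation by (rule continuous_on_subset[OF contY]) auto
      show "Y ` {0..<s} \<subseteq> psd_mats"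
        using before pd_imp_psd by fastforce
    qed
    ultimately show ?thesis
      using s by auto
  qed
  have zero: "v \<bullet> (Y s *v v) = 0"
    using psd_nonneg[OF psd, of v] nonpos by simp
  have "0 \<le> v \<bullet> (G (Y s) *v v)"
    using quasi_pos[OF psd psd_kernel[OF psd zero]] .
  moreover have "0 < v \<bullet> ((Y' s - G (Y s)) *v v)"
    using pd_pos[OF ineq v] s by blast
  ultimately have pos: "0 < v \<bullet> (Y' s *v v)"
    by (simp add: algebra_simps inner_diff_right)
  have "((\<lambda>r. v \<bullet> (Y r *v v)) has_real_derivative v \<bullet> (Y' s *v v)) (at s within {0..})"
    unfolding quadratic_form_eq_inner has_real_derivative_iff_has_vector_derivative
    by (intro bounded_linear.has_vector_derivative[OF bounded_linear_inner_left] deriv s)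
  then obtain d where d: "0 < d"
    "\<And>h. 0 < h \<Longrightarrow> s - h \<in> {0..} \<Longrightarrow> h < d \<Longrightarrow> v \<bullet> (Y (s - h) *v v) < v \<bullet> (Y s *v v)"
    using has_real_derivative_pos_inc_left[OF _ pos] by blast
  \<comment> \<open>The minimum with \<open>s\<close> keeps \<open>s - h\<close> in the time
    domain.\<close>
  define h where "h = min (d / 2) s"
  have h: "0 < h" "h < d" "h \<le> s"
    using d s \<open>s \<noteq> 0\<close> by (auto simp: h_def min_def)
  then have "v \<bullet> (Y (s - h) *v v) < 0"
    using d(2)[of h] zero by simp
  moreover have "0 < v \<bullet> (Y (s - h) *v v)"
    using pd_pos[OF before v, of "s - h"] h by simp
  ultimately show False
    by simp
qed

text \<open>Adding \<open>e * exp (k * t)\<close> times the identity makes both hypotheses strict;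
  letting \<open>e\<close> tend to 0 recovers \<open>Y t\<close>.\<close>

lemma comparison:
  assumes deriv: "\<And>t. 0 \<le> t \<Longrightarrow> (Y has_vector_derivative Y' t) (at t within {0..})"
    and sym_Y: "\<And>t. 0 \<le> t \<Longrightarrow> Y t \<in> sym_mats"
    and init: "Y 0 \<in> psd_mats"
    and ineq: "\<And>t. 0 \<le> t \<Longrightarrow> Y' t - G (Y t) \<in> psd_mats"
    and t: "0 \<le> t"
  shows "Y t \<in> psd_mats"
proof -
  \<comment> \<open>This \<open>k\<close> exceeds the norm of \<open>G (mat 1)\<close>, so the
    derivative of the added term strictly dominates its image under \<open>G\<close>.\<close>
  define k where "k = norm (G (mat 1)) + 1"
  have "k *\<^sub>R mat 1 - G (mat 1) = (norm (G (mat 1)) *\<^sub>R mat 1 - G (mat 1)) + mat 1"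
    by (simp add: k_def algebra_simps)
  then have k: "k *\<^sub>R mat 1 - G (mat 1) \<in> pd_mats"
    using psd_add_pd[OF identity_shift_psd[OF sym[OF mat_1_sym]] mat_1_pd] by (simp only:)
  define Z where "Z e t = Y t + (e * exp (k * t)) *\<^sub>R mat 1" for e t
  have Z: "Z e t \<in> pd_mats" if e: "0 < e" for e
  proof (rule strict_comparison[OF _ _ _ _ t])
    show "(Z e has_vector_derivative Y' s + (e * (k * exp (k * s))) *\<^sub>R mat 1) (at s within {0..})"
      if "0 \<le> s" for s
      unfolding Z_def by (auto intro!: derivative_eq_intros deriv that)
    show "Z e s \<in> sym_mats" if "0 \<le> s" for s
      unfolding Z_def by (intro sym_mats_intros sym_Y that)
    show "Z e 0 \<in> pd_mats"
      unfolding Z_def by (intro psd_add_pd init pd_scaleR mat_1_pd) (simp add: e)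
    show "Y' s + (e * (k * exp (k * s))) *\<^sub>R mat 1 - G (Z e s) \<in> pd_mats" if "0 \<le> s" for s
    proof -
      have "(Y' s - G (Y s)) + (e * exp (k * s)) *\<^sub>R (k *\<^sub>R mat 1 - G (mat 1)) \<in> pd_mats"
        by (intro psd_add_pd ineq that pd_scaleR k) (simp add: e)
      then show ?thesis
        by (simp add: Z_def linear_add[OF linear] linear_cmul[OF linear] algebra_simps)
    qed
  qed
  have "((\<lambda>e. Z e t) \<longlongrightarrow> Y t + (0 * exp (k * t)) *\<^sub>R mat 1) (at_right 0)"
    unfolding Z_def by (intro tendsto_intros)
  moreover have "\<forall>\<^sub>F e in at_right 0. Z e t \<in> psd_mats"
    using Z pd_imp_psd by (intro eventually_at_right_less[THEN eventually_mono]) blast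
  ultimately have "Y t + (0 * exp (k * t)) *\<^sub>R mat 1 \<in> psd_mats"
    by (intro Lim_in_closed_set[OF closed_psd_mats]) auto
  then show ?thesis
    by simp
qed

end

section \<open>Nonnegative real eigenvalues, duality and the two spectra\<close>

lemma linear_image_subspace_eq:
  fixes f :: "'a::euclidean_space \<Rightarrow> 'a"
  assumes f: "linear f" and S: "subspace S" "\<And>x. x \<in> S \<Longrightarrow> f x \<in> S"
    and ker: "\<And>x. x \<in> S \<Longrightarrow> f x = 0 \<Longrightarrow> x = 0"
  shows "f ` S = S"
proof (rule subspace_dim_equal)
  show "subspace (f ` S)"
    using f S(1) by (rule linear_subspace_image)
  show "subspace S" "f ` S \<subseteq> S"
    using S by auto
  have "span S = S"
    using S(1) by (simp add: span_eq_iff)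
  moreover have "inj_on f S"
    using linear_injective_on_subspace_0[OF f S(1)] ker by blast
  ultimately have "inj_on f (span S)"
    by metis
  then show "dim S \<le> dim (f ` S)"
    by (simp add: dim_image_eq[OF f])
qed

text \<open>For linear \<open>G\<close> preserving \<open>sym_mats\<close>, this is invertibility of
  \<open>l - G\<close> there for all \<open>l \<ge> 0\<close>. It is the property that passes
  between the operator and its adjoint.\<close>

definition nonneg_eigenvalue_free :: "(real ^ 'n ^ 'n \<Rightarrow> real ^ 'n ^ 'n) \<Rightarrow> bool" where
  "nonneg_eigenvalue_free G \<longleftrightarrow> (\<forall>l\<ge>0. \<forall>X\<in>sym_mats. G X = l *\<^sub>R X \<longrightarrow> X = 0)"

lemma resolvent_image_sym:
  assumes free: "nonneg_eigenvalue_free G" and G: "linear G" "\<And>X. X \<in> sym_mats \<Longrightarrow> G X \<in> sym_mats"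
    and l: "0 \<le> l"
  shows "(\<lambda>X. l *\<^sub>R X - G X) ` sym_mats = sym_mats"
proof (rule linear_image_subspace_eq[OF _ subspace_sym_mats])
  show "linear (\<lambda>X. l *\<^sub>R X - G X)"
    by (intro linear_compose_sub linear_scaleR G)
  show "l *\<^sub>R X - G X \<in> sym_mats" if "X \<in> sym_mats" for X
    by (intro sym_mats_intros G that)
  show "X = 0" if "X \<in> sym_mats" "l *\<^sub>R X - G X = 0" for X
    using free l that by (simp add: nonneg_eigenvalue_free_def)
qed

text \<open>An eigenmatrix of \<open>H\<close> for \<open>l\<close> is orthogonal to the range of
  \<open>l - G\<close>. That range is all of \<open>sym_mats\<close>, so the eigenmatrix is
  orthogonal to itself.\<close>

lemma nonneg_eigenvalue_free_adjoint:
  assumes free: "nonneg_eigenvalue_free G" and G: "linear G" "\<And>X. X \<in> sym_mats \<Longrightarrow> G X \<in> sym_mats"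
    and adj: "\<And>X Y. G X \<bullet> Y = X \<bullet> H Y"
  shows "nonneg_eigenvalue_free H"
  unfolding nonneg_eigenvalue_free_def
proof (intro allI ballI impI)
  fix l :: real and Y
  assume l: "0 \<le> l" and Y: "Y \<in> sym_mats" and HY: "H Y = l *\<^sub>R Y"
  have "Y \<in> (\<lambda>X. l *\<^sub>R X - G X) ` sym_mats"
    using Y resolvent_image_sym[OF free G l] by simp
  then obtain X where X: "Y = l *\<^sub>R X - G X"
    by blast
  have "Y \<bullet> Y = l * (X \<bullet> Y) - G X \<bullet> Y"
    by (subst (1) X) (simp add: inner_diff_left)
  also have "\<dots> = 0"
    by (simp add: adj HY)
  finally show "Y = 0"
    by simp
qed

text \<open>Real and imaginary parts of the eigenvalue equation for \<open>U + i V\<close>.\<close>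

lemma op_spectrum_complex_iff:
  "Complex a b \<in> op_spectrum_complex G \<longleftrightarrow>
     (\<exists>U\<in>sym_mats. \<exists>V\<in>sym_mats. (U \<noteq> 0 \<or> V \<noteq> 0) \<and>
        G U = a *\<^sub>R U - b *\<^sub>R V \<and> G V = a *\<^sub>R V + b *\<^sub>R U)"
  unfolding op_spectrum_complex_def by (simp add: vec_eq_iff complex_eq_iff algebra_simps) (metis add.commute)

lemma op_spectrum_subset_complex:
  assumes "linear G"
  shows "op_spectrum G \<subseteq> op_spectrum_complex G"
proof
  fix z assume "z \<in> op_spectrum G"
  then obtain X where X: "X \<in> sym_mats" "X \<noteq> 0"
    and eig: "complex_mat (G X) = (\<chi> i j. z * complex_mat X $ i $ j)"
    by (auto simp: op_spectrum_def)
  have "complex_of_real (G X $ i $ j) = z * complex_of_real (X $ i $ j)" for i j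
    using eig by (simp add: vec_eq_iff complex_mat_def)
  then show "z \<in> op_spectrum_complex G"
    using X linear_0[OF assms] unfolding op_spectrum_complex_def
    by (intro CollectI bexI[of _ X] bexI[of _ 0]) (auto simp: complex_of_real_def sym_mats_intros)
qed

lemma nonneg_eigenvalue_free_if_op_spectrum:
  assumes "op_spectrum G \<subseteq> {z. Re z < 0}"
  shows "nonneg_eigenvalue_free G"
  unfolding nonneg_eigenvalue_free_def
proof (intro allI ballI impI)
  fix l :: real and X
  assume l: "0 \<le> l" and X: "X \<in> sym_mats" "G X = l *\<^sub>R X"
  have "complex_mat (G X) = (\<chi> i j. complex_of_real l * complex_mat X $ i $ j)"
    by (simp add: X complex_mat_def vec_eq_iff)
  then have "complex_of_real l \<in> op_spectrum G" if "X \<noteq> 0"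
    using that X by (auto simp: op_spectrum_def)
  then show "X = 0"
    using assms l by force
qed

section \<open>Positive definite solutions, decay and the spectrum\<close>

context quasi_positive
begin

text \<open>Keeps solutions off the boundary of the cone: a null vector \<open>v\<close> of
  \<open>P\<close> would satisfy \<open>v \<bullet> v = - (v \<bullet> (G P *v v))\<close>, which
  quasi-positivity makes nonpositive.\<close>

lemma pd_if_psd_resolvent:
  assumes P: "P \<in> psd_mats" and eq: "l *\<^sub>R P - G P = mat 1"
  shows "P \<in> pd_mats"
proof (rule ccontr)
  assume "P \<notin> pd_mats"
  then obtain v where v: "v \<noteq> 0" "v \<bullet> (P *v v) \<le> 0"
    using P by (auto simp: pd_mats_def psd_mats_def not_less)
  then have Pv: "P *v v = 0"
    using psd_kernel[OF P] psd_nonneg[OF P, of v] by simp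
  have "v \<bullet> v = v \<bullet> ((l *\<^sub>R P - G P) *v v)"
    by (simp add: eq)
  also have "\<dots> = - (v \<bullet> (G P *v v))"
    by (simp add: Pv matrix_vector_mult_diff_rdistrib matrix_vector_mult_scaleR_left)
  also have "\<dots> \<le> 0"
    using quasi_pos[OF P Pv] by simp
  finally show False
    using v inner_gt_zero_iff[of v] by linarith
qed

text \<open>Here \<open>l P\<close> is the identity plus \<open>G P\<close>, so it suffices that
  \<open>norm (G P) < 1\<close>. The value of \<open>l\<close> ensures this because
  \<open>l - K\<close> exceeds \<open>K * norm (mat 1)\<close> by 1.\<close>

lemma pd_resolvent_large:
  assumes K: "\<And>X. norm (G X) \<le> norm X * K" "0 \<le> K"
    and l: "l = K + K * norm (mat 1 :: real ^ 'n ^ 'n) + 1"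
    and P: "P \<in> sym_mats" and eq: "l *\<^sub>R P - G P = mat 1"
  shows "P \<in> pd_mats"
proof -
  let ?m = "norm (mat 1 :: real ^ 'n ^ 'n)"
  have l0: "0 < l" and lK: "0 < l - K"
    using K(2) by (auto simp: l intro!: add_nonneg_pos)
  have lP: "l *\<^sub>R P = mat 1 + G P"
    using eq by (simp add: algebra_simps)
  have "l * norm P = norm (mat 1 + G P)"
    using l0 by (simp flip: lP)
  also have "\<dots> \<le> ?m + norm P * K"
    using norm_triangle_ineq[of "mat 1" "G P"] K(1)[of P] by linarith
  finally have "(l - K) * norm P \<le> ?m"
    by (simp add: algebra_simps)
  then have "(l - K) * (K * norm P) \<le> K * ?m"
    using mult_left_mono[OF _ K(2)] by (simp add: mult.left_commute)
  also have "\<dots> < (l - K) * 1"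
    by (simp add: l)
  finally have "norm P * K < 1"
    using lK by (simp add: mult.commute)
  then have less1: "norm (G P) < 1"
    using K(1)[of P] by linarith
  have "norm (- G P) *\<^sub>R mat 1 - (- G P) \<in> psd_mats"
    by (intro identity_shift_psd sym_mats_intros sym P)
  then have "(norm (- G P) *\<^sub>R mat 1 - (- G P)) + (1 - norm (G P)) *\<^sub>R mat 1 \<in> pd_mats"
    using less1 by (intro psd_add_pd pd_scaleR mat_1_pd) auto
  then have "(1 / l) *\<^sub>R (l *\<^sub>R P) \<in> pd_mats"
    using l0 unfolding lP by (intro pd_scaleR) (simp_all add: algebra_simps)
  then show ?thesis
    using l0 by simp
qed

text \<open>Being injective on a subspace of finite dimension, \<open>l - G\<close> is bounded below
  there by some \<open>c\<close>. Applied to \<open>D = R k - R l\<close>, which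
  \<open>l - G\<close> maps to \<open>(l - k) R k\<close>, this bounds the increment of
  \<open>R\<close>.\<close>

lemma continuous_resolvent:
  assumes free: "nonneg_eigenvalue_free G"
    and R: "\<And>l. 0 \<le> l \<Longrightarrow> R l \<in> sym_mats" "\<And>l. 0 \<le> l \<Longrightarrow> l *\<^sub>R R l - G (R l) = B"
  shows "continuous_on {0..} R"
  unfolding continuous_on_def
proof
  fix l :: real assume "l \<in> {0..}"
  then have l: "0 \<le> l"
    by simp
  have blin: "bounded_linear (\<lambda>X. l *\<^sub>R X - G X)"
    unfolding linear_conv_bounded_linear[symmetric]
    by (intro linear_compose_sub linear_scaleR linear)
  have "\<exists>c>0. \<forall>X\<in>sym_mats. c * norm X \<le> norm (l *\<^sub>R X - G X)"
    using free l by (intro injective_imp_isometric blin closed_subspace subspace_sym_mats)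
      (auto simp: nonneg_eigenvalue_free_def)
  then obtain c where c: "0 < c"
    "\<And>X. X \<in> sym_mats \<Longrightarrow> c * norm X \<le> norm (l *\<^sub>R X - G X)"
    by blast
  have bound: "norm (R k - R l) \<le> \<bar>k - l\<bar> * (2 / c * norm (R l))"
    if k: "0 \<le> k" "\<bar>k - l\<bar> < c / 2" for k
  proof -
    define D where "D = R k - R l"
    have "k *\<^sub>R R k - G (R k) = l *\<^sub>R R l - G (R l)"
      using R(2) l k by simp
    then have "l *\<^sub>R D - G D = (l - k) *\<^sub>R R k"
      by (simp add: D_def linear_diff[OF linear] algebra_simps)
    moreover have "c * norm D \<le> norm (l *\<^sub>R D - G D)"
      unfolding D_def by (intro c sym_mats_intros R l k)
    ultimately have "c * norm D \<le> \<bar>k - l\<bar> * norm (R k)"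
      by (simp add: abs_minus_commute)
    also have "\<dots> \<le> \<bar>k - l\<bar> * (norm (R l) + norm D)"
      using norm_triangle_ineq[of "R l" D] by (intro mult_left_mono) (auto simp: D_def)
    \<comment> \<open>Closeness of \<open>k\<close> to \<open>l\<close> makes the last term half of
      the left side, which absorbs it and leaves the factor \<open>2 / c\<close>.\<close>
    also have "\<dots> \<le> \<bar>k - l\<bar> * norm (R l) + c / 2 * norm D"
      using mult_right_mono[of "\<bar>k - l\<bar>" "c / 2" "norm D"] k by (simp add: distrib_left)
    finally show ?thesis
      using c by (simp add: D_def field_simps)
  qed
  have "((\<lambda>k. R k - R l) \<longlongrightarrow> 0) (at l within {0..})"
  proof (rule Lim_null_comparison)
    have "\<forall>\<^sub>F k in at l within {0..}. k \<in> {0..} \<and> dist k l < c / 2"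
      unfolding eventually_at using c(1) by (intro exI[of _ "c / 2"]) auto
    then show "\<forall>\<^sub>F k in at l within {0..}. norm (R k - R l) \<le> \<bar>k - l\<bar> * (2 / c * norm (R l))"
      by (rule eventually_mono) (use bound in \<open>auto simp: dist_real_def\<close>)
    show "((\<lambda>k. \<bar>k - l\<bar> * (2 / c * norm (R l))) \<longlongrightarrow> 0) (at l within {0..})"
      using c(1) by (auto intro!: tendsto_eq_intros)
  qed
  then show "(R \<longlongrightarrow> R l) (at l within {0..})"
    by (rule LIM_zero_cancel)
qed

text \<open>
  The solution \<open>R l\<close> of \<open>l R l - G (R l) = I\<close> depends continuously on \<open>l \<ge> 0\<close>, is positive definite
  for large \<open>l\<close>, and by quasi-positivity cannot leave the open cone through its boundary as \<open>l\<close>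
  decreases to \<open>0\<close>.
\<close>

lemma pd_solution_exists:
  assumes free: "nonneg_eigenvalue_free G"
  obtains P where "P \<in> pd_mats" "G P = - mat 1"
proof -
  have "\<exists>P. P \<in> sym_mats \<and> l *\<^sub>R P - G P = mat 1" if l: "0 \<le> l" for l
  proof -
    have "mat 1 \<in> (\<lambda>X. l *\<^sub>R X - G X) ` sym_mats"
      using resolvent_image_sym[OF free linear sym l] mat_1_sym by simp
    then show ?thesis
      by auto
  qed
  then obtain R where R: "\<And>l. 0 \<le> l \<Longrightarrow> R l \<in> sym_mats"
    "\<And>l. 0 \<le> l \<Longrightarrow> l *\<^sub>R R l - G (R l) = mat 1"
    by metis
  have contR: "continuous_on {0..} R"
    by (rule continuous_resolvent[OF free R])
  define T where "T = {0..} \<inter> R -` psd_mats"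
  \<comment> \<open>Along \<open>R\<close> semidefinite already means definite, so \<open>T\<close>
    is the preimage of a closed set and also of an open one; connectedness of the half-line then
    makes it everything.\<close>
  have "R l \<in> psd_mats \<longleftrightarrow> (\<forall>v. v \<noteq> 0 \<longrightarrow> 0 < v \<bullet> (R l *v v))" if l: "0 \<le> l" for l
  proof -
    have "R l \<in> psd_mats \<longleftrightarrow> R l \<in> pd_mats"
      using pd_if_psd_resolvent[OF _ R(2)[OF l]] pd_imp_psd by blast
    then show ?thesis
      using R(1)[OF l] by (simp add: pd_mats_def)
  qed
  then have "T = {0..} \<inter> R -` {X. \<forall>v. v \<noteq> 0 \<longrightarrow> 0 < v \<bullet> (X *v v)}"
    by (auto simp: T_def)
  then have "openin (top_of_set {0..}) T"
    using continuous_openin_preimage_gen[OF contR open_positive_forms] by simp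
  moreover have "closedin (top_of_set {0..}) T"
    unfolding T_def by (rule continuous_closedin_preimage[OF contR closed_psd_mats])
  moreover have "connected {0 :: real..}"
    by simp
  moreover have "T \<noteq> {}"
  proof -
    obtain K where K: "\<And>X. norm (G X) \<le> norm X * K" "0 \<le> K"
      using bounded_linear.nonneg_bounded[OF linear_conv_bounded_linear[THEN iffD1, OF linear]]
      by blast
    define l where "l = K + K * norm (mat 1 :: real ^ 'n ^ 'n) + 1"
    have "0 \<le> l"
      using K(2) by (simp add: l_def)
    then have "l \<in> T"
      using pd_resolvent_large[OF K l_def R] pd_imp_psd by (simp add: T_def)
    then show ?thesis
      by blast
  qed
  ultimately have "T = {0..}"
    unfolding connected_clopen by blast
  then have "R 0 \<in> psd_mats"
    by (auto simp: T_def)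
  show thesis
  proof
    show "R 0 \<in> pd_mats"
      by (rule pd_if_psd_resolvent[OF \<open>R 0 \<in> psd_mats\<close> R(2)]) simp
    show "G (R 0) = - mat 1"
      using R(2)[of 0] by (simp add: equation_minus_iff)
  qed
qed

text \<open>A rate \<open>a\<close> with \<open>a P \<le> Q\<close> gives
  \<open>G P \<le> - a P\<close>, so decaying multiples of \<open>P\<close> are barriers for both
  \<open>X\<close> and \<open>- X\<close> by \<open>comparison\<close>. The resulting bound on the
  form is then turned into a norm bound.\<close>

lemma exponentially_stable_if_pd:
  assumes P: "P \<in> pd_mats" and Q: "Q \<in> pd_mats" and eq: "G P + Q = 0"
  shows "exponentially_stable G"
proof -
  obtain c where c: "0 < c" "\<And>v. c * (v \<bullet> v) \<le> v \<bullet> (P *v v)"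
    using P by (auto simp: pd_mats_def elim: pd_lower_bound)
  obtain q where q: "0 < q" "\<And>v. q * (v \<bullet> v) \<le> v \<bullet> (Q *v v)"
    using Q by (auto simp: pd_mats_def elim: pd_lower_bound)
  \<comment> \<open>Then \<open>q / a = norm P + q\<close>, which is at least \<open>norm P\<close>,
    as \<open>scaled_pd_minus_psd\<close> requires.\<close>
  define a where "a = 1 / (norm P / q + 1)"
  have a: "0 < a"
    using q(1) by (simp add: a_def add_nonneg_pos)
  have "(1 / a) *\<^sub>R Q - P \<in> psd_mats"
    using a q(1) by (intro scaled_pd_minus_psd[OF pd_in_sym[OF P] Q q(2)]) (auto simp: a_def field_simps)
  then have "a *\<^sub>R ((1 / a) *\<^sub>R Q - P) \<in> psd_mats"
    using a by (intro psd_scaleR) auto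
  then have QP: "Q - a *\<^sub>R P \<in> psd_mats"
    using a by (simp add: algebra_simps)
  define b where "b = real (CARD('n) * CARD('n)) * (norm P / c)"
  have main: "norm (X t) \<le> b * exp (- a * t) * norm X0"
    if X0: "X0 \<in> sym_mats" and sol: "is_solution G X0 X" and t: "0 \<le> t" for X0 X t
  proof -
    have symX: "X s \<in> sym_mats" and derivX: "(X has_vector_derivative G (X s)) (at s within {0..})"
      if "0 \<le> s" for s
      using sol that by (auto simp: is_solution_def)
    have init: "X 0 = X0"
      using sol by (simp add: is_solution_def)
    \<comment> \<open>Normalized so that \<open>e 0 * c = norm X0\<close>, which lets
      \<open>e 0 *\<^sub>R P\<close> dominate \<open>X0\<close> and \<open>- X0\<close>.\<close>
    define e where "e s = norm X0 / c * exp (- a * s)" for s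
    have e: "0 \<le> e s" for s
      using c(1) by (simp add: e_def)
    have Y: "e t *\<^sub>R P + r *\<^sub>R X t \<in> psd_mats" if r: "\<bar>r\<bar> = 1" for r
    proof (rule comparison[OF _ _ _ _ t])
      show "((\<lambda>s. e s *\<^sub>R P + r *\<^sub>R X s) has_vector_derivative
          (- a * e s) *\<^sub>R P + r *\<^sub>R G (X s)) (at s within {0..})" if "0 \<le> s" for s
        unfolding e_def using c(1) by (auto intro!: derivative_eq_intros derivX that)
      show "e s *\<^sub>R P + r *\<^sub>R X s \<in> sym_mats" if "0 \<le> s" for s
        by (intro sym_mats_intros pd_in_sym P symX that)
      have "e 0 *\<^sub>R P - (- r) *\<^sub>R X 0 \<in> psd_mats"
        using c(1) r by (intro scaled_pd_minus_psd[OF _ P c(2)] sym_mats_intros symX e)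
          (simp_all add: e_def init)
      then show "e 0 *\<^sub>R P + r *\<^sub>R X 0 \<in> psd_mats"
        by simp
      show "(- a * e s) *\<^sub>R P + r *\<^sub>R G (X s) - G (e s *\<^sub>R P + r *\<^sub>R X s) \<in> psd_mats" for s
      proof -
        have "G P = - Q"
          using eq by (simp add: eq_neg_iff_add_eq_0)
        then have "(- a * e s) *\<^sub>R P + r *\<^sub>R G (X s) - G (e s *\<^sub>R P + r *\<^sub>R X s)
            = e s *\<^sub>R (Q - a *\<^sub>R P)"
          by (simp add: linear_add[OF linear] linear_cmul[OF linear] algebra_simps)
        then show ?thesis
          using psd_scaleR[OF QP e] by simp
      qed
    qed
    have "norm (X t) \<le> real (CARD('n) * CARD('n)) * (e t * norm P)"
    proof (rule norm_le_quadratic_form_bound[OF symX[OF t]])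
      fix v
      have "0 \<le> v \<bullet> ((e t *\<^sub>R P + 1 *\<^sub>R X t) *v v)" "0 \<le> v \<bullet> ((e t *\<^sub>R P + (- 1) *\<^sub>R X t) *v v)"
        by (intro psd_nonneg Y; simp)+
      then have "\<bar>v \<bullet> (X t *v v)\<bar> \<le> e t * (v \<bullet> (P *v v))"
        by (simp add: algebra_simps inner_add_right inner_diff_right matrix_vector_mult_scaleR_left
            abs_le_iff)
      also have "\<dots> \<le> e t * (norm P * (v \<bullet> v))"
        using abs_quadratic_form_le[of v P] by (intro mult_left_mono e) linarith
      finally show "\<bar>v \<bullet> (X t *v v)\<bar> \<le> e t * norm P * (v \<bullet> v)"
        by (simp add: mult.assoc)
    qed
    also have "\<dots> = b * exp (- a * t) * norm X0"
      by (simp add: b_def e_def)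
    finally show ?thesis .
  qed
  \<comment> \<open>The maximum meets the demand of \<open>exponentially_stable\<close> that the
    factor be at least 1.\<close>
  have "norm (X t) \<le> max 1 b * exp (- a * t) * norm X0"
    if "X0 \<in> psd_mats" "is_solution G X0 X" "0 \<le> t" for X0 X t
  proof -
    have "norm (X t) \<le> b * exp (- a * t) * norm X0"
      using that psd_in_sym by (intro main)
    also have "\<dots> \<le> max 1 b * exp (- a * t) * norm X0"
      by (intro mult_right_mono) auto
    finally show ?thesis .
  qed
  then show ?thesis
    unfolding exponentially_stable_def using a
    by (intro exI[of _ a] conjI exI[of _ "max 1 b"]) auto
qed

text \<open>Stability only controls positive semidefinite initial values. A symmetric
  \<open>X0\<close> is the difference of two of them, \<open>norm X0\<close> times the identity and
  that multiple minus \<open>X0\<close>, and solutions subtract by linearity.\<close>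

lemma solution_tendsto_0:
  assumes stable: "exponentially_stable G" and X0: "X0 \<in> sym_mats" and X: "is_solution G X0 X"
  shows "(X \<longlongrightarrow> 0) at_top"
proof -
  have psd_case: "(Z \<longlongrightarrow> 0) at_top" if "Z0 \<in> psd_mats" "is_solution G Z0 Z" for Z0 Z
  proof -
    obtain a b where a: "0 < a" and stable_ab: "\<forall>X0\<in>psd_mats. \<forall>X. is_solution G X0 X \<longrightarrow>
        (\<forall>t\<ge>0. norm (X t) \<le> b * exp (- a * t) * norm X0)"
      using stable unfolding exponentially_stable_def by metis
    have b: "norm (Z t) \<le> b * exp (- a * t) * norm Z0" if "0 \<le> t" for t
      using stable_ab \<open>Z0 \<in> psd_mats\<close> \<open>is_solution G Z0 Z\<close> that by simp
    show ?thesis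
    proof (rule Lim_null_comparison)
      show "\<forall>\<^sub>F t in at_top. norm (Z t) \<le> b * exp (- a * t) * norm Z0"
        using b eventually_ge_at_top[of 0] by (rule eventually_mono[rotated])
      have "((\<lambda>t. exp (- a * t)) \<longlongrightarrow> 0) at_top"
        using a by (intro filterlim_compose[OF exp_at_bot]
            filterlim_tendsto_neg_mult_at_bot[OF tendsto_const _ filterlim_ident]) auto
      then show "((\<lambda>t. b * exp (- a * t) * norm Z0) \<longlongrightarrow> 0) at_top"
        by (intro tendsto_mult_left_zero tendsto_mult_right_zero)
    qed
  qed
  define Z0 where "Z0 = norm X0 *\<^sub>R (mat 1 :: real ^ 'n ^ 'n)"
  have Z0: "Z0 \<in> psd_mats"
    unfolding Z0_def by (intro psd_scaleR pd_imp_psd mat_1_pd) simp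
  obtain Z where Z: "Z 0 = Z0" "\<And>t. Z t \<in> sym_mats"
    "\<And>t. (Z has_vector_derivative G (Z t)) (at t)"
    using linear_ode_solution_exists[OF linear subspace_sym_mats sym psd_in_sym[OF Z0]] by blast
  then have Z_sol: "is_solution G Z0 Z"
    by (auto simp: is_solution_def intro: has_vector_derivative_at_within)
  have ZX_sol: "is_solution G (Z0 - X0) (\<lambda>t. Z t - X t)"
    unfolding is_solution_def
  proof (intro conjI allI impI)
    show "Z 0 - X 0 = Z0 - X0"
      using X Z(1) by (simp add: is_solution_def)
    fix t :: real assume "0 \<le> t"
    then have Xt: "X t \<in> sym_mats" "(X has_vector_derivative G (X t)) (at t within {0..})"
      using X by (auto simp: is_solution_def)
    show "Z t - X t \<in> sym_mats"
      by (rule subspace_diff[OF subspace_sym_mats Z(2) Xt(1)])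
    show "((\<lambda>t. Z t - X t) has_vector_derivative G (Z t - X t)) (at t within {0..})"
      unfolding linear_diff[OF linear]
      by (rule has_vector_derivative_diff[OF has_vector_derivative_at_within[OF Z(3)] Xt(2)])
  qed
  have "Z0 - X0 \<in> psd_mats"
    unfolding Z0_def by (rule identity_shift_psd[OF X0])
  then have "((\<lambda>t. Z t - (Z t - X t)) \<longlongrightarrow> 0 - 0) at_top"
    by (intro tendsto_diff psd_case[OF Z0 Z_sol] psd_case[OF _ ZX_sol])
  then show ?thesis
    by simp
qed

text \<open>If \<open>Re z \<ge> 0\<close>, the solutions built from
  \<open>exp (z t) (U + i V)\<close> tend to 0, yet multiplying by \<open>exp (- z t)\<close>, of
  modulus at most 1, gives back \<open>U\<close> and \<open>V\<close>, which must then
  vanish.\<close>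

lemma op_spectrum_complex_if_stable:
  assumes stable: "exponentially_stable G"
  shows "op_spectrum_complex G \<subseteq> {z. Re z < 0}"
proof
  fix z assume z: "z \<in> op_spectrum_complex G"
  obtain a b where ab: "z = Complex a b"
    by (cases z)
  obtain U V where UV: "U \<in> sym_mats" "V \<in> sym_mats" "U \<noteq> 0 \<or> V \<noteq> 0"
    and G: "G U = a *\<^sub>R U - b *\<^sub>R V" "G V = a *\<^sub>R V + b *\<^sub>R U"
    using z unfolding ab op_spectrum_complex_iff by blast
  show "z \<in> {z. Re z < 0}"
  proof (rule ccontr)
    assume "z \<notin> {z. Re z < 0}"
    then have a: "0 \<le> a"
      by (simp add: ab)
    \<comment> \<open>\<open>X\<close> and \<open>Y\<close> are the real and imaginary parts of
      \<open>exp (z t) (U + i V)\<close>.\<close>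
    define X where "X t = (exp (a * t) * cos (b * t)) *\<^sub>R U - (exp (a * t) * sin (b * t)) *\<^sub>R V" for t
    define Y where "Y t = (exp (a * t) * sin (b * t)) *\<^sub>R U + (exp (a * t) * cos (b * t)) *\<^sub>R V" for t
    have "is_solution G U X" "is_solution G V Y"
      unfolding is_solution_def X_def Y_def
      by (auto intro!: sym_mats_intros UV derivative_eq_intros
          simp: linear_diff[OF linear] linear_add[OF linear] linear_cmul[OF linear] G algebra_simps)
    then have XY: "(X \<longlongrightarrow> 0) at_top" "(Y \<longlongrightarrow> 0) at_top"
      by (auto intro: solution_tendsto_0[OF stable] UV)
    have cs: "\<bar>exp (- a * t) * cos (b * t)\<bar> \<le> 1" "\<bar>exp (- a * t) * sin (b * t)\<bar> \<le> 1" if "0 \<le> t" for t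
      using a that by (auto simp: abs_mult intro!: mult_le_one)
    \<comment> \<open>Real and imaginary parts of
      \<open>exp (- z t) (X + i Y) = U + i V\<close>.\<close>
    have U: "U = (exp (- a * t) * cos (b * t)) *\<^sub>R X t + (exp (- a * t) * sin (b * t)) *\<^sub>R Y t"
      and V: "V = (exp (- a * t) * cos (b * t)) *\<^sub>R Y t - (exp (- a * t) * sin (b * t)) *\<^sub>R X t" for t
    proof -
      have e: "exp (- a * t) * exp (a * t) = 1"
        by (simp flip: exp_add)
      have cc: "cos (b * t) * cos (b * t) + sin (b * t) * sin (b * t) = 1"
        using sin_cos_squared_add3 by blast
      have "(exp (- a * t) * cos (b * t)) *\<^sub>R X t + (exp (- a * t) * sin (b * t)) *\<^sub>R Y t
          = ((exp (- a * t) * exp (a * t)) * (cos (b * t) * cos (b * t) + sin (b * t) * sin (b * t))) *\<^sub>R U"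
        by (simp only: X_def Y_def) (simp add: algebra_simps del: sin_cos_squared_add3)
      then show "U = (exp (- a * t) * cos (b * t)) *\<^sub>R X t + (exp (- a * t) * sin (b * t)) *\<^sub>R Y t"
        unfolding e cc by simp
      have "(exp (- a * t) * cos (b * t)) *\<^sub>R Y t - (exp (- a * t) * sin (b * t)) *\<^sub>R X t
          = ((exp (- a * t) * exp (a * t)) * (cos (b * t) * cos (b * t) + sin (b * t) * sin (b * t))) *\<^sub>R V"
        by (simp only: X_def Y_def) (simp add: algebra_simps del: sin_cos_squared_add3)
      then show "V = (exp (- a * t) * cos (b * t)) *\<^sub>R Y t - (exp (- a * t) * sin (b * t)) *\<^sub>R X t"
        unfolding e cc by simp
    qed
    have lim: "((\<lambda>t. norm (X t) + norm (Y t)) \<longlongrightarrow> 0) at_top"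
      using XY by (auto intro!: tendsto_eq_intros)
    have small: "norm W \<le> 0" if "\<And>t. 0 \<le> t \<Longrightarrow> norm W \<le> norm (X t) + norm (Y t)"
      for W :: "real ^ 'n ^ 'n"
      using that by (intro tendsto_lowerbound[OF lim] trivial_limit_at_top_linorder
          eventually_at_top_linorderI[of 0])
    have contract: "norm ((exp (- a * t) * cos (b * t)) *\<^sub>R W) \<le> norm W"
      "norm ((exp (- a * t) * sin (b * t)) *\<^sub>R W) \<le> norm W" if "0 \<le> t" for t and W :: "real ^ 'n ^ 'n"
      unfolding norm_scaleR real_norm_def
      by (intro mult_left_le_one_le cs that norm_ge_zero abs_ge_zero)+
    have "norm U \<le> norm (X t) + norm (Y t)" if "0 \<le> t" for t
      by (subst U[of t]) (intro order.trans[OF norm_triangle_ineq] add_mono contract that)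
    moreover have "norm V \<le> norm (X t) + norm (Y t)" if "0 \<le> t" for t
      by (subst V[of t], subst add.commute)
        (intro order.trans[OF norm_triangle_ineq4] add_mono contract that)
    ultimately show False
      using small UV(3) by auto
  qed
qed

end

section \<open>The Lyapunov operator and its adjoint\<close>

text \<open>Lets quasi-positivity be proved once for both operators.\<close>

lemma lyap_adj_eq_lyap_op: "lyap_adj A N \<mu> = lyap_op (\<lambda>i. transpose (A i)) N \<mu>"
  by (simp add: fun_eq_iff lyap_adj_def lyap_op_def)

lemma matrix_mult_row_eq: "(A ** X) $ i = (\<Sum>k\<in>UNIV. A $ i $ k *\<^sub>R X $ k)"
  for A :: "real ^ 'n ^ 'm"
  by (simp add: vec_eq_iff matrix_matrix_mult_def)

lemma inner_matrix_mult_left: "(A ** X) \<bullet> Y = X \<bullet> (transpose A ** Y)"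
  for A :: "real ^ 'n ^ 'm"
proof -
  have "(A ** X) \<bullet> Y = (\<Sum>i\<in>UNIV. \<Sum>k\<in>UNIV. A $ i $ k * (X $ k \<bullet> Y $ i))"
    by (simp add: inner_vec_def[of "A ** X"] matrix_mult_row_eq inner_sum_left)
  also have "\<dots> = (\<Sum>k\<in>UNIV. \<Sum>i\<in>UNIV. A $ i $ k * (X $ k \<bullet> Y $ i))"
    by (rule sum.swap)
  also have "\<dots> = X \<bullet> (transpose A ** Y)"
    by (simp add: inner_vec_def[of X] matrix_mult_row_eq inner_sum_right transpose_def)
  finally show ?thesis .
qed

lemma inner_transpose: "transpose X \<bullet> transpose Y = X \<bullet> Y" for X :: "real ^ 'n ^ 'm"
  by (simp add: inner_vec_def transpose_def) (rule sum.swap)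

lemma inner_matrix_mult_right: "(X ** B) \<bullet> Y = X \<bullet> (Y ** transpose B)"
  for B :: "real ^ 'n ^ 'm"
proof -
  have "(X ** B) \<bullet> Y = (transpose B ** transpose X) \<bullet> transpose Y"
    unfolding matrix_transpose_mul[symmetric] inner_transpose ..
  also have "\<dots> = transpose X \<bullet> transpose (Y ** transpose B)"
    unfolding inner_matrix_mult_left matrix_transpose_mul ..
  finally show ?thesis
    unfolding inner_transpose .
qed

lemma lyap_op_adjoint: "lyap_op A N \<mu> X \<bullet> Y = X \<bullet> lyap_adj A N \<mu> Y"
proof -
  have "(A ** X ** transpose A) \<bullet> Y = X \<bullet> (transpose A ** Y ** A)" for A
    by (metis inner_matrix_mult_right inner_matrix_mult_left matrix_mul_assoc transpose_transpose)
  moreover have "(A ** X) \<bullet> Y = X \<bullet> (transpose A ** Y)"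
    "(X ** transpose A) \<bullet> Y = X \<bullet> (Y ** A)" for A
    by (rule inner_matrix_mult_left) (metis inner_matrix_mult_right transpose_transpose)
  ultimately show ?thesis
    by (simp only: lyap_op_def lyap_adj_def inner_add_left inner_add_right inner_sum_left
        inner_sum_right inner_scaleR_left inner_scaleR_right)
qed

lemma lyap_adj_adjoint: "lyap_adj A N \<mu> X \<bullet> Y = X \<bullet> lyap_op A N \<mu> Y"
  using lyap_op_adjoint[of A N \<mu> Y X] by (simp only: inner_commute)

lemma linear_matrix_mult_both: "linear (\<lambda>X. A ** X ** B)" for A :: "real ^ 'n ^ 'm"
proof -
  have "linear (\<lambda>X. X ** B)"
    by (intro linearI) (simp_all add: vec_eq_iff matrix_matrix_mult_def distrib_right
        sum.distrib sum_distrib_left mult.assoc)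
  moreover have "linear ((**) A)"
    by (intro linearI) (simp_all only: matrix_add_ldistrib matrix_scalar_ac scalar_matrix_assoc)
  ultimately show ?thesis
    using linear_compose[of "(**) A" "\<lambda>X. X ** B"] by (simp add: o_def)
qed

lemma linear_lyap_op: "linear (lyap_op A N \<mu>)"
proof -
  \<comment> \<open>Identity factors bring the two one-sided products into the form covered by
    \<open>linear_matrix_mult_both\<close>.\<close>
  have "lyap_op A N \<mu> = (\<lambda>X. A 0 ** X ** mat 1 + mat 1 ** X ** transpose (A 0) +
      (\<Sum>i=1..N. A i ** X ** transpose (A i)) + \<mu> *\<^sub>R X)"
    by (simp add: fun_eq_iff lyap_op_def)
  moreover have "linear \<dots>"
    by (intro linear_compose_add linear_compose_sum ballI linear_scaleR linear_matrix_mult_both)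
  ultimately show ?thesis
    by simp
qed

lemma linear_transpose: "linear (transpose :: real ^ 'n ^ 'm \<Rightarrow> real ^ 'm ^ 'n)"
  by (intro linearI) (simp_all add: transpose_def vec_eq_iff)

lemma congruence_sym: "X \<in> sym_mats \<Longrightarrow> B ** X ** transpose B \<in> sym_mats"
  by (simp add: sym_mats_def matrix_transpose_mul matrix_mul_assoc)

lemma lyap_op_sym: "X \<in> sym_mats \<Longrightarrow> lyap_op A N \<mu> X \<in> sym_mats"
proof -
  assume X: "X \<in> sym_mats"
  \<comment> \<open>The two summands are transposes of each other.\<close>
  then have "A 0 ** X + X ** transpose (A 0) \<in> sym_mats"
    by (simp add: sym_mats_def linear_add[OF linear_transpose] matrix_transpose_mul add.commute)
  then show ?thesis
    unfolding lyap_op_def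
    by (intro subspace_add[OF subspace_sym_mats, of "_ + _"] sym_mats_intros(3,6) congruence_sym X)
qed

lemma inner_matrix_vector_mult: "v \<bullet> (B *v y) = (transpose B *v v) \<bullet> y"
  for B :: "real ^ 'n ^ 'm"
  by (simp add: dot_lmul_matrix)

lemma quadratic_form_sum: "v \<bullet> ((\<Sum>i\<in>I. X i) *v v) = (\<Sum>i\<in>I. v \<bullet> (X i *v v))"
  for X :: "'i \<Rightarrow> real ^ 'n ^ 'n"
  by (simp add: quadratic_form_eq_inner inner_sum_left)

text \<open>At a null vector of \<open>X\<close> the terms with \<open>A 0\<close> and
  \<open>\<mu>\<close> contribute nothing, one of them by symmetry of \<open>X\<close>; the others
  are congruences of \<open>X\<close> and hence semidefinite.\<close>

lemma quasi_positive_lyap_op: "quasi_positive (lyap_op A N \<mu>)"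
  for A :: "nat \<Rightarrow> real ^ 'n ^ 'n"
proof (rule quasi_positive.intro)
  show "linear (lyap_op A N \<mu>)"
    by (rule linear_lyap_op)
  show "lyap_op A N \<mu> X \<in> sym_mats" if "X \<in> sym_mats" for X
    using that by (rule lyap_op_sym)
next
  fix X :: "real ^ 'n ^ 'n" and v
  assume X: "X \<in> psd_mats" and Xv: "X *v v = 0"
  have left: "v \<bullet> ((A 0 ** X) *v v) = 0"
    by (simp add: Xv flip: matrix_vector_mul_assoc)
  have "v \<bullet> ((X ** transpose (A 0)) *v v) = v \<bullet> (X *v (transpose (A 0) *v v))"
    by (simp only: matrix_vector_mul_assoc)
  also have "\<dots> = 0"
    by (subst sym_inner_mult[OF psd_in_sym[OF X]]) (simp add: Xv)
  finally have right: "v \<bullet> ((X ** transpose (A 0)) *v v) = 0" .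
  have "0 \<le> v \<bullet> ((A i ** X ** transpose (A i)) *v v)" for i
  proof -
    have "v \<bullet> ((A i ** X ** transpose (A i)) *v v) =
        (transpose (A i) *v v) \<bullet> (X *v (transpose (A i) *v v))"
      by (simp only: inner_matrix_vector_mult flip: matrix_vector_mul_assoc)
    then show ?thesis
      using psd_nonneg[OF X] by simp
  qed
  then have "0 \<le> v \<bullet> ((\<Sum>i=1..N. A i ** X ** transpose (A i)) *v v)"
    unfolding quadratic_form_sum by (intro sum_nonneg)
  then show "0 \<le> v \<bullet> (lyap_op A N \<mu> X *v v)"
    unfolding lyap_op_def matrix_vector_mult_add_rdistrib inner_add_right left right
    by (simp add: Xv matrix_vector_mult_scaleR_left)
qed

text \<open>One cycle serves all three: stability, complexified spectrum, real spectrum, certificate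
  for the adjoint, stability.\<close>

lemma
  fixes A :: "nat \<Rightarrow> real ^ 'n ^ 'n"
  shows exponentially_stable_iff_pd:
  "exponentially_stable (lyap_op A N \<mu>) \<longleftrightarrow>
     (\<exists>P\<in>pd_mats. \<exists>Q\<in>pd_mats. lyap_adj A N \<mu> P + Q = 0)"
  (is "?stable \<longleftrightarrow> ?pd")
  and exponentially_stable_iff_op_spectrum:
  "exponentially_stable (lyap_op A N \<mu>) \<longleftrightarrow> op_spectrum (lyap_op A N \<mu>) \<subseteq> {z. Re z < 0}"
  (is "_ \<longleftrightarrow> ?spec")
  and exponentially_stable_iff_op_spectrum_complex:
  "exponentially_stable (lyap_op A N \<mu>) \<longleftrightarrow>
     op_spectrum_complex (lyap_op A N \<mu>) \<subseteq> {z. Re z < 0}"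
  (is "_ \<longleftrightarrow> ?specc")
proof -
  interpret C: quasi_positive "lyap_op A N \<mu>"
    by (rule quasi_positive_lyap_op)
  interpret D: quasi_positive "lyap_adj A N \<mu>"
    unfolding lyap_adj_eq_lyap_op by (rule quasi_positive_lyap_op)
  have to_free: "nonneg_eigenvalue_free G"
    if "quasi_positive G" "exponentially_stable G" for G :: "real ^ 'n ^ 'n \<Rightarrow> real ^ 'n ^ 'n"
    by (meson that nonneg_eigenvalue_free_if_op_spectrum op_spectrum_subset_complex order.trans
        quasi_positive.linear quasi_positive.op_spectrum_complex_if_stable)
  have 1: "?stable \<Longrightarrow> ?specc"
    by (rule C.op_spectrum_complex_if_stable)
  have 2: "?specc \<Longrightarrow> ?spec"
    using op_spectrum_subset_complex[OF linear_lyap_op] by blast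
  have 3: "?spec \<Longrightarrow> ?pd"
  proof -
    assume ?spec
    then have "nonneg_eigenvalue_free (lyap_adj A N \<mu>)"
      by (intro nonneg_eigenvalue_free_adjoint[OF nonneg_eigenvalue_free_if_op_spectrum
            linear_lyap_op lyap_op_sym lyap_op_adjoint])
    then obtain P where "P \<in> pd_mats" "lyap_adj A N \<mu> P = - mat 1"
      by (rule D.pd_solution_exists)
    then show ?pd
      using mat_1_pd by (metis add.left_inverse)
  qed
  \<comment> \<open>The certificate directly yields decay of the adjoint system only. Duality moves
    the absence of nonnegative eigenvalues to \<open>lyap_op\<close>, which then has a certificate
    of its own.\<close>
  have 4: "?pd \<Longrightarrow> ?stable"
  proof -
    assume ?pd
    then have "exponentially_stable (lyap_adj A N \<mu>)"
      using D.exponentially_stable_if_pd by blast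
    then have "nonneg_eigenvalue_free (lyap_adj A N \<mu>)"
      by (rule to_free[OF D.quasi_positive_axioms])
    then have "nonneg_eigenvalue_free (lyap_op A N \<mu>)"
      by (rule nonneg_eigenvalue_free_adjoint[OF _ D.linear D.sym])
        (assumption, rule lyap_adj_adjoint)
    then obtain P where P: "P \<in> pd_mats" "lyap_op A N \<mu> P = - mat 1"
      by (rule C.pd_solution_exists)
    show ?stable
      using P(1) mat_1_pd by (rule C.exponentially_stable_if_pd) (simp only: P(2) left_minus)
  qed
  show "?stable \<longleftrightarrow> ?pd"
    by (rule iffI[OF 3[OF 2[OF 1]] 4])
  show "?stable \<longleftrightarrow> ?spec"
    by (rule iffI[OF 2[OF 1] 4[OF 3]])
  show "?stable \<longleftrightarrow> ?specc"
    by (rule iffI[OF 1 4[OF 3[OF 2]]])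
qed

text \<open>The margin is a lower bound for the form of \<open>Q\<close> on unit vectors; conversely
  the negated image of \<open>P\<close> serves as \<open>Q\<close>.\<close>

lemma lyap_adj_pd_iff_loewner:
  "(\<exists>P\<in>pd_mats. \<exists>Q\<in>pd_mats. lyap_adj A N \<mu> P + Q = 0) \<longleftrightarrow>
     (\<exists>P\<in>pd_mats. \<exists>c>0. lyap_adj A N \<mu> P \<preceq>\<^sub>L - c *\<^sub>R mat 1)"
proof (intro iffI; elim bexE exE conjE)
  fix P Q assume P: "P \<in> pd_mats" and Q: "Q \<in> pd_mats" and eq: "lyap_adj A N \<mu> P + Q = 0"
  obtain c where c: "0 < c" "\<And>v. c * (v \<bullet> v) \<le> v \<bullet> (Q *v v)"
    using Q by (auto simp: pd_mats_def elim: pd_lower_bound)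
  have LP: "lyap_adj A N \<mu> P = - Q"
    using eq by (simp add: eq_neg_iff_add_eq_0)
  have "Q - c *\<^sub>R mat 1 \<in> psd_mats"
    using c pd_in_sym[OF Q] by (auto simp: psd_mats_def sym_mats_intros inner_diff_right
        matrix_vector_mult_diff_rdistrib matrix_vector_mult_scaleR_left)
  then have "lyap_adj A N \<mu> P \<preceq>\<^sub>L - c *\<^sub>R mat 1"
    using pd_in_sym[OF Q] by (simp add: loewner_le_def LP sym_mats_intros)
  then show "\<exists>P\<in>pd_mats. \<exists>c>0. lyap_adj A N \<mu> P \<preceq>\<^sub>L - c *\<^sub>R mat 1"
    using P c(1) by blast
next
  fix P c assume P: "P \<in> pd_mats" and c: "(0::real) < c"
    and le: "lyap_adj A N \<mu> P \<preceq>\<^sub>L - c *\<^sub>R mat 1"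
  have "(- c *\<^sub>R mat 1 - lyap_adj A N \<mu> P) + c *\<^sub>R mat 1 \<in> pd_mats"
    using le c by (intro psd_add_pd pd_scaleR mat_1_pd) (auto simp: loewner_le_def)
  then have "- lyap_adj A N \<mu> P \<in> pd_mats"
    by simp
  then show "\<exists>P\<in>pd_mats. \<exists>Q\<in>pd_mats. lyap_adj A N \<mu> P + Q = 0"
    using P by (metis add.right_inverse)
qed

section \<open>The matrix of the Lyapunov operator\<close>

text \<open>Splits an eigenvector as \<open>u + i w\<close>, in the same shape as
  \<open>op_spectrum_complex_iff\<close>, so that the two spectra can be compared through real
  data.\<close>

lemma Complex_in_eigenvalues_iff:
  "Complex a b \<in> eigenvalues M \<longleftrightarrow>
     (\<exists>u w. (u \<noteq> 0 \<or> w \<noteq> 0) \<and> M *v u = a *\<^sub>R u - b *\<^sub>R w \<and> M *v w = a *\<^sub>R w + b *\<^sub>R u)"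
proof -
  have eq: "complex_mat M *v v = Complex a b *s v \<longleftrightarrow>
      M *v u = a *\<^sub>R u - b *\<^sub>R w \<and> M *v w = a *\<^sub>R w + b *\<^sub>R u"
    if "u = (\<chi> i. Re (v $ i))" "w = (\<chi> i. Im (v $ i))" for u w v
    by (simp add: that vec_eq_iff complex_eq_iff complex_mat_def matrix_vector_mult_def
        all_conj_distrib)
  show ?thesis
  proof
    assume "Complex a b \<in> eigenvalues M"
    then obtain v where v: "v \<noteq> 0" "complex_mat M *v v = Complex a b *s v"
      by (auto simp: eigenvalues_def)
    then show "\<exists>u w. (u \<noteq> 0 \<or> w \<noteq> 0) \<and> M *v u = a *\<^sub>R u - b *\<^sub>R w \<and> M *v w = a *\<^sub>R w + b *\<^sub>R u"
      using eq[OF refl refl, of v]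
      by (intro exI[of _ "\<chi> i. Re (v $ i)"] exI[of _ "\<chi> i. Im (v $ i)"])
        (auto simp: vec_eq_iff complex_eq_iff)
  next
    assume "\<exists>u w. (u \<noteq> 0 \<or> w \<noteq> 0) \<and> M *v u = a *\<^sub>R u - b *\<^sub>R w \<and> M *v w = a *\<^sub>R w + b *\<^sub>R u"
    then obtain u w where uw: "u \<noteq> 0 \<or> w \<noteq> 0"
      "M *v u = a *\<^sub>R u - b *\<^sub>R w" "M *v w = a *\<^sub>R w + b *\<^sub>R u"
      by blast
    then show "Complex a b \<in> eigenvalues M"
      using eq[of u "\<chi> i. Complex (u $ i) (w $ i)" w] unfolding eigenvalues_def
      by (intro CollectI exI[of _ "\<chi> i. Complex (u $ i) (w $ i)"])
        (auto simp: vec_eq_iff complex_eq_iff)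
  qed
qed

text \<open>The classical vectorization identity: with index pairs (column, row), the first factor
  acts on columns, hence from the right and transposed.\<close>

lemma kronecker_mult_vec_mat: "(A \<otimes>\<^sub>K B) *v vec_mat X = vec_mat (B ** X ** transpose A)"
proof -
  have "(\<Sum>q\<in>UNIV. A $ c $ fst q * B $ r $ snd q * X $ snd q $ fst q) =
      (\<Sum>k\<in>UNIV. (\<Sum>l\<in>UNIV. B $ r $ l * X $ l $ k) * A $ c $ k)" for c r
  proof -
    have "(\<Sum>q\<in>UNIV. A $ c $ fst q * B $ r $ snd q * X $ snd q $ fst q) =
        (\<Sum>k\<in>UNIV. \<Sum>l\<in>UNIV. A $ c $ k * B $ r $ l * X $ l $ k)"
      unfolding UNIV_Times_UNIV[symmetric] sum.cartesian_product by (simp add: case_prod_unfold)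
    then show ?thesis
      by (simp add: sum_distrib_left sum_distrib_right mult_ac)
  qed
  then show ?thesis
    by (simp add: vec_eq_iff kronecker_def vec_mat_def matrix_vector_mult_def
        matrix_matrix_mult_def transpose_def)
qed

lemma linear_vec_mat: "linear vec_mat"
  by (intro linearI) (simp_all add: vec_mat_def vec_eq_iff)

lemma linear_vec_bar: "linear vec_bar"
  by (intro linearI) (auto simp: vec_bar_def vec_eq_iff Let_def case_prod_unfold algebra_simps)

lemma sum_matrix_vector_mult: "(\<Sum>i\<in>I. M i) *v v = (\<Sum>i\<in>I. M i *v v)"
  for M :: "'i \<Rightarrow> real ^ 'n ^ 'm"
  by (induction I rule: infinite_finite_induct) (auto simp: matrix_vector_mult_add_rdistrib)

lemma vec_bar_surj_on_sym:
  fixes y :: "real ^ ('n::{finite, linorder}) low_tri"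
  obtains X where "X \<in> sym_mats" "vec_bar X = y"
proof
  \<comment> \<open>Minimum and maximum select the stored lower-triangular position for both
    \<open>(i, j)\<close> and \<open>(j, i)\<close>; the divisor undoes the off-diagonal
    weight.\<close>
  define X :: "real ^ ('n::{finite, linorder}) ^ ('n::{finite, linorder})" where
    "X = (\<chi> i j. y $ Abs_low_tri (min i j, max i j) / (if i = j then 1 else sqrt 2))"
  show "X \<in> sym_mats"
    by (auto simp: sym_mats_def transpose_def X_def vec_eq_iff min.commute max.commute)
  show "vec_bar X = y"
  proof -
    have "vec_bar X $ k = y $ k" for k
    proof -
      obtain j i where k: "Rep_low_tri k = (j, i)"
        by fastforce
      then have "j \<le> i"
        using Rep_low_tri[of k] by simp
      moreover have "Abs_low_tri (j, i) = k"
        by (metis k Rep_low_tri_inverse)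
      ultimately show ?thesis
        by (auto simp: vec_bar_def k X_def min_absorb2 max_absorb1 min_absorb1 max_absorb2)
    qed
    then show ?thesis
      by (simp add: vec_eq_iff)
  qed
qed

section \<open>Correspondence between \<open>lyap_matrix\<close> and \<open>lyap_op\<close>\<close>

context
  fixes F :: "real ^ ('n::{finite, linorder}) low_tri ^ ('n \<times> 'n)"
  assumes orth: "transpose F ** F = mat 1"
    and F: "\<forall>X\<in>sym_mats. vec_mat X = F *v vec_bar X"
begin

lemma vec_bar_inj_on_sym:
  fixes X Y :: "real ^ ('n::{finite, linorder}) ^ ('n::{finite, linorder})"
  assumes X: "X \<in> sym_mats" "Y \<in> sym_mats" and eq: "vec_bar X = vec_bar Y"
  shows "X = Y"
proof -
  have "vec_mat X = vec_mat Y"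
    using F X eq by metis
  then show ?thesis
    by (simp add: vec_mat_def vec_eq_iff)
qed

text \<open>The Kronecker sum acts on \<open>vec_mat X\<close> as \<open>lyap_op\<close> on
  \<open>X\<close>. The image is symmetric again, so its vectorization lies in the range of
  \<open>F\<close>, where \<open>transpose F\<close> inverts \<open>F\<close>.\<close>

lemma lyap_matrix_mult_vec_bar:
  fixes X :: "real ^ ('n::{finite, linorder}) ^ ('n::{finite, linorder})"
  assumes X: "X \<in> sym_mats"
  shows "lyap_matrix A N \<mu> F *v vec_bar X = vec_bar (lyap_op A N \<mu> X)"
proof -
  have "(mat 1 \<otimes>\<^sub>K A 0 + A 0 \<otimes>\<^sub>K mat 1 + (\<Sum>i=1..N. A i \<otimes>\<^sub>K A i) + \<mu> *\<^sub>R mat 1) *v vec_mat X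
      = vec_mat (lyap_op A N \<mu> X)"
    by (simp add: matrix_vector_mult_add_rdistrib sum_matrix_vector_mult
        matrix_vector_mult_scaleR_left kronecker_mult_vec_mat lyap_op_def
        linear_add[OF linear_vec_mat] linear_sum[OF linear_vec_mat] linear_cmul[OF linear_vec_mat])
  moreover have "F *v vec_bar X = vec_mat X"
    using F X by simp
  ultimately have "lyap_matrix A N \<mu> F *v vec_bar X = transpose F *v vec_mat (lyap_op A N \<mu> X)"
    by (simp only: lyap_matrix_def flip: matrix_vector_mul_assoc)
  also have "\<dots> = transpose F *v (F *v vec_bar (lyap_op A N \<mu> X))"
    using F lyap_op_sym[OF X] by simp
  also have "\<dots> = vec_bar (lyap_op A N \<mu> X)"
    unfolding matrix_vector_mul_assoc orth by simp
  finally show ?thesis .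
qed

text \<open>On symmetric matrices \<open>vec_bar\<close> is a linear bijection intertwining the two
  maps, so their complexified eigenvalue problems correspond.\<close>

lemma eigenvalues_lyap_matrix:
  "eigenvalues (lyap_matrix A N \<mu> F) = op_spectrum_complex (lyap_op A N \<mu>)"
proof -
  let ?M = "lyap_matrix A N \<mu> F" and ?L = "lyap_op A N \<mu>"
  note lin = linear_add[OF linear_vec_bar] linear_diff[OF linear_vec_bar]
    linear_cmul[OF linear_vec_bar]
  have iff: "?M *v vec_bar U = a *\<^sub>R vec_bar U - b *\<^sub>R vec_bar V \<longleftrightarrow> ?L U = a *\<^sub>R U - b *\<^sub>R V"
    if "U \<in> sym_mats" "V \<in> sym_mats" for U V a b
    using vec_bar_inj_on_sym[OF lyap_op_sym[OF that(1)], of "a *\<^sub>R U - b *\<^sub>R V" A N \<mu>] that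
    by (auto simp: lyap_matrix_mult_vec_bar lin[symmetric] sym_mats_intros)
  have zero: "vec_bar U = 0 \<longleftrightarrow> U = 0" if "U \<in> sym_mats"
    for U :: "real ^ ('n::{finite, linorder}) ^ ('n::{finite, linorder})"
    using vec_bar_inj_on_sym[OF that subspace_0[OF subspace_sym_mats]] linear_0[OF linear_vec_bar]
    by auto
  have "Complex a b \<in> eigenvalues ?M \<longleftrightarrow> Complex a b \<in> op_spectrum_complex ?L" for a b
  proof -
    have "Complex a b \<in> eigenvalues ?M \<longleftrightarrow> (\<exists>U\<in>sym_mats. \<exists>V\<in>sym_mats.
        (vec_bar U \<noteq> 0 \<or> vec_bar V \<noteq> 0) \<and>
        ?M *v vec_bar U = a *\<^sub>R vec_bar U - b *\<^sub>R vec_bar V \<and>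
        ?M *v vec_bar V = a *\<^sub>R vec_bar V + b *\<^sub>R vec_bar U)"
      unfolding Complex_in_eigenvalues_iff by (metis vec_bar_surj_on_sym)
    also have "\<dots> \<longleftrightarrow> Complex a b \<in> op_spectrum_complex ?L"
      unfolding op_spectrum_complex_iff
      \<comment> \<open>The second eigenvalue equation is the first with the two matrices exchanged
        and \<open>- b\<close> for \<open>b\<close>.\<close>
      using iff[of _ _ a b] iff[of _ _ a "- b"] zero by (intro bex_cong refl) auto
    finally show ?thesis .
  qed
  then show ?thesis
    by (metis complex_surj subsetI subset_antisym)
qed

end

theorem theorem3p4:
  fixes A :: "nat \<Rightarrow> real ^ ('n::{finite, linorder}) ^ ('n::{finite, linorder})"
    and N :: nat and \<mu> :: real
    and F :: "real ^ 'n low_tri ^ ('n \<times> 'n)"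
  assumes "transpose F ** F = mat 1"
    and "\<forall>X\<in>sym_mats. vec_mat X = F *v vec_bar X"
  shows "(exponentially_stable (lyap_op A N \<mu>) \<longleftrightarrow>
            (\<exists>P\<in>pd_mats. \<exists>Q\<in>pd_mats. lyap_adj A N \<mu> P + Q = 0)) \<and>
         ((\<exists>P\<in>pd_mats. \<exists>Q\<in>pd_mats. lyap_adj A N \<mu> P + Q = 0) \<longleftrightarrow>
            (\<exists>P\<in>pd_mats. \<exists>\<alpha>\<^sub>3>0. lyap_adj A N \<mu> P \<preceq>\<^sub>L - \<alpha>\<^sub>3 *\<^sub>R mat 1)) \<and>
         (exponentially_stable (lyap_op A N \<mu>) \<longleftrightarrow> hurwitz_stable (lyap_matrix A N \<mu> F)) \<and>
         (exponentially_stable (lyap_op A N \<mu>) \<longleftrightarrow>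
            op_spectrum (lyap_op A N \<mu>) \<subseteq> {z. Re z < 0}) \<and>
         (exponentially_stable (lyap_op A N \<mu>) \<longleftrightarrow>
            op_spectrum_complex (lyap_op A N \<mu>) \<subseteq> {z. Re z < 0})"
  unfolding hurwitz_stable_def eigenvalues_lyap_matrix[OF assms]
  by (intro conjI exponentially_stable_iff_pd lyap_adj_pd_iff_loewner
      exponentially_stable_iff_op_spectrum exponentially_stable_iff_op_spectrum_complex)

end
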